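(* Let $p\not\equiv0$ be a smooth two-phase solution of the focusing NLS equation with non-singular spectral curve, whose branch points are $\lambda_1=\lambda_2^*=r_1+is_1$, $\lambda_3=\lambda_4^*=r_2+is_2$, $\lambda_5=\lambda_6^*=r_3+is_3$ with $r_j\in\mathbb R$ and $0<s_1\le s_2\le s_3$. Then $$\sup_{(x,t)\in\mathbb R^2}|p(x,t)|=s_1+s_2+s_3,$$ and $$\inf_{(x,t)\in\mathbb R^2}|p(x,t)|=\begin{cases}s_3-s_1-s_2,& s_3>s_1+s_2,\\ 0,& s_3\le s_1+s_2.\end{cases}$$ (Equivalently $|p|^2=\nu_1$ oscillates between $(s_1+s_2+s_3)^2$ and $(s_1+s_2-s_3)^2$ or $0$, respectively.)
   Context: Let $p(x,t)$, $(x,t)\in\mathbb R^2$, be a smooth complex-valued solution of the focusing nonlinear Schrödinger equation $ip_t+p_{xx}+2|p|^2p=0$; $^*$ denotes complex conjugation and subscripts denote partial derivatives. Put $\mathbb U=\begin{pmatrix}-i\lambda& ip\\ ip^*& i\lambda\end{pmatrix}$ and $\mathbb V=\begin{pmatrix}-2i\lambda^2+i|p|^2& 2i\lambda p-p_x\\ 2i\lambda p^*+p^*_x& 2i\lambda^2-i|p|^2\end{pmatrix}$. The solution $p$ is called a two-phase solution if there exist real constants $c_0,c_1,c_2$ such that the matrix $\Psi=\begin{pmatrix}\Psi_{11}&\Psi_{12}\\ \Psi_{21}&-\Psi_{11}\end{pmatrix}$ with $\Psi_{11}=-i\lambda^3-ic_2\lambda^2+(\tfrac12 i|p|^2-ic_1)\lambda+\tfrac14(pp^*_x-p_xp^*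 )+\tfrac12 ic_2|p|^2-ic_0$, $\Psi_{12}=ip\lambda^2+(-\tfrac12p_x+ic_2p)\lambda-\tfrac14 ip_{xx}-\tfrac12 ip|p|^2-\tfrac12c_2p_x+ic_1p$, $\Psi_{21}=ip^*\lambda^2+(\tfrac12p^*_x+ic_2p^* )\lambda-\tfrac14 ip^*_{xx}-\tfrac12 ip^*|p|^2+\tfrac12c_2p^*_x+ic_1p^*$ satisfies $\Psi_x=[\mathbb U,\Psi]$ and $\Psi_t=[\mathbb V,\Psi]$ identically in $\lambda\in\mathbb C$. The polynomial $\mathscr R(\lambda)=-\Psi_{11}^2-\Psi_{12}\Psi_{21}$ is monic of degree 6 and independent of $(x,t)$; its roots $\lambda_1,\dots,\lambda_6$ are the branch points of the spectral curve $w^2=\mathscr R(\lambda)$, which is non-singular if they are pairwise distinct (in which case they necessarily form three complex-conjugate pairs for such $p$). *)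

theory Defs
  imports "HOL-Analysis.Analysis"
begin

definition dx :: "(real \<times> real \<Rightarrow> complex) \<Rightarrow> real \<times> real \<Rightarrow> complex" where
  "dx f = (\<lambda>(x, t). vector_derivative (\<lambda>y. f (y, t)) (at x))"

definition dt :: "(real \<times> real \<Rightarrow> complex) \<Rightarrow> real \<times> real \<Rightarrow> complex" where
  "dt f = (\<lambda>(x, t). vector_derivative (\<lambda>s. f (x, s)) (at t))"

fun pd :: "bool list \<Rightarrow> (real \<times> real \<Rightarrow> complex) \<Rightarrow> real \<times> real \<Rightarrow> complex" where
  "pd [] f = f"
| "pd (True # ds) f = dx (pd ds f)"
| "pd (False # ds) f = dt (pd ds f)"

definition smooth2 :: "(real \<times> real \<Rightarrow> complex) \<Rightarrow> bool" where
  "smooth2 f \<longleftrightarrow> (\<forall>ds z. pd ds f differentiable (at z))"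

definition focusing_NLS :: "(real \<times> real \<Rightarrow> complex) \<Rightarrow> bool" where
  "focusing_NLS p \<longleftrightarrow> (\<forall>z. \<i> * dt p z + dx (dx p) z + 2 * complex_of_real ((cmod (p z))\<^sup>2) * p z = 0)"

definition mat2 :: "complex \<Rightarrow> complex \<Rightarrow> complex \<Rightarrow> complex \<Rightarrow> complex^2^2" where
  "mat2 a b c d = (\<chi> i j. if i = 1 then (if j = 1 then a else b) else (if j = 1 then c else d))"

definition commutator :: "complex^2^2 \<Rightarrow> complex^2^2 \<Rightarrow> complex^2^2" where
  "commutator A B = A ** B - B ** A"

definition mdx :: "(real \<times> real \<Rightarrow> complex^2^2) \<Rightarrow> real \<times> real \<Rightarrow> complex^2^2" where
  "mdx M z = (\<chi> i j. dx (\<lambda>w. M w $ i $ j) z)"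

definition mdt :: "(real \<times> real \<Rightarrow> complex^2^2) \<Rightarrow> real \<times> real \<Rightarrow> complex^2^2" where
  "mdt M z = (\<chi> i j. dt (\<lambda>w. M w $ i $ j) z)"

definition sqabs :: "(real \<times> real \<Rightarrow> complex) \<Rightarrow> real \<times> real \<Rightarrow> complex" where
  "sqabs p z = complex_of_real ((cmod (p z))\<^sup>2)"

definition laxU :: "(real \<times> real \<Rightarrow> complex) \<Rightarrow> complex \<Rightarrow> real \<times> real \<Rightarrow> complex^2^2" where
  "laxU p l z = mat2 (- \<i> * l) (\<i> * p z) (\<i> * cnj (p z)) (\<i> * l)"

definition laxV :: "(real \<times> real \<Rightarrow> complex) \<Rightarrow> complex \<Rightarrow> real \<times> real \<Rightarrow> complex^2^2" where
  "laxV p l z = mat2 (- 2 * \<i> * l\<^sup>2 + \<i> * sqabs p z)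
                     (2 * \<i> * l * p z - dx p z)
                     (2 * \<i> * l * cnj (p z) + dx (\<lambda>w. cnj (p w)) z)
                     (2 * \<i> * l\<^sup>2 - \<i> * sqabs p z)"

definition Psi11 :: "(real \<times> real \<Rightarrow> complex) \<Rightarrow> real \<Rightarrow> real \<Rightarrow> real \<Rightarrow> complex \<Rightarrow> real \<times> real \<Rightarrow> complex" where
  "Psi11 p c0 c1 c2 l z =
     - \<i> * l^3 - \<i> * c2 * l\<^sup>2 + (\<i> / 2 * sqabs p z - \<i> * c1) * l
     + (p z * dx (\<lambda>w. cnj (p w)) z - dx p z * cnj (p z)) / 4
     + \<i> / 2 * c2 * sqabs p z - \<i> * c0"

definition Psi12 :: "(real \<times> real \<Rightarrow> complex) \<Rightarrow> real \<Rightarrow> real \<Rightarrow> real \<Rightarrow> complex \<Rightarrow> real \<times> real \<Rightarrow> complex" where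
  "Psi12 p c0 c1 c2 l z =
     \<i> * p z * l\<^sup>2 + (- dx p z / 2 + \<i> * c2 * p z) * l
     - \<i> / 4 * dx (dx p) z - \<i> / 2 * p z * sqabs p z - c2 / 2 * dx p z + \<i> * c1 * p z"

definition Psi21 :: "(real \<times> real \<Rightarrow> complex) \<Rightarrow> real \<Rightarrow> real \<Rightarrow> real \<Rightarrow> complex \<Rightarrow> real \<times> real \<Rightarrow> complex" where
  "Psi21 p c0 c1 c2 l z =
     \<i> * cnj (p z) * l\<^sup>2 + (dx (\<lambda>w. cnj (p w)) z / 2 + \<i> * c2 * cnj (p z)) * l
     - \<i> / 4 * dx (dx (\<lambda>w. cnj (p w))) z - \<i> / 2 * cnj (p z) * sqabs p z
     + c2 / 2 * dx (\<lambda>w. cnj (p w)) z + \<i> * c1 * cnj (p z)"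

definition Psi :: "(real \<times> real \<Rightarrow> complex) \<Rightarrow> real \<Rightarrow> real \<Rightarrow> real \<Rightarrow> complex \<Rightarrow> real \<times> real \<Rightarrow> complex^2^2" where
  "Psi p c0 c1 c2 l z = mat2 (Psi11 p c0 c1 c2 l z) (Psi12 p c0 c1 c2 l z)
                             (Psi21 p c0 c1 c2 l z) (- Psi11 p c0 c1 c2 l z)"

definition two_phase :: "(real \<times> real \<Rightarrow> complex) \<Rightarrow> real \<Rightarrow> real \<Rightarrow> real \<Rightarrow> bool" where
  "two_phase p c0 c1 c2 \<longleftrightarrow>
     (\<forall>l z. mdx (Psi p c0 c1 c2 l) z = commutator (laxU p l z) (Psi p c0 c1 c2 l z)
          \<and> mdt (Psi p c0 c1 c2 l) z = commutator (laxV p l z) (Psi p c0 c1 c2 l z))"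

definition spectral_R :: "(real \<times> real \<Rightarrow> complex) \<Rightarrow> real \<Rightarrow> real \<Rightarrow> real \<Rightarrow> complex \<Rightarrow> real \<times> real \<Rightarrow> complex" where
  "spectral_R p c0 c1 c2 l z = - (Psi11 p c0 c1 c2 l z)\<^sup>2 - Psi12 p c0 c1 c2 l z * Psi21 p c0 c1 c2 l z"

end

theory Submission
  imports Defs
begin

text \<open>Write \<open>\<Psi>\<^sub>1\<^sub>2 = \<i>(P \<lambda>\<^sup>2 + Q \<lambda> + W)\<close> and \<open>\<Psi>\<^sub>1\<^sub>1 = -\<i>f\<close> with \<open>f\<close> a real monic cubic. The spectral
  identity \<open>f\<^sup>2 + |P \<lambda>\<^sup>2 + Q \<lambda> + W|\<^sup>2 = \<R>(\<lambda>)\<close> bounds the orbit \<open>(P, Q, W)\<close>, and on the compact closure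
  of the orbit \<open>|P|\<^sup>2\<close> attains its extrema. There the first derivatives of \<open>|p|\<^sup>2\<close> vanish and its
  Hessian is semidefinite. Vanishing derivatives mean that \<open>P \<lambda>\<^sup>2 + Q \<lambda> + W = P m(\<lambda>)\<close> with \<open>m\<close> real, so
  \<open>\<R> = (f + \<i>|P|m)(f - \<i>|P|m)\<close>; each factor picks one root out of every conjugate pair, whence
  \<open>|P| = \<plusminus>s\<^sub>1 \<plusminus> s\<^sub>2 \<plusminus> s\<^sub>3\<close>. The Hessian determinant is a negative multiple of the resultant of \<open>m\<close> and \<open>f\<close>,
  and evaluating that resultant at the roots of \<open>f + \<i>|P|m\<close> shows that semidefiniteness forces the
  product of the three signs to be positive. This leaves \<open>s\<^sub>1 + s\<^sub>2 + s\<^sub>3\<close> and \<open>s\<^sub>3 - s\<^sub>1 - s\<^sub>2\<close>, which are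
  told apart because the Hessian is never zero, so \<open>|p|\<close> is not constant. Finally, \<open>P = 0\<close> makes
  \<open>\<R> - f\<^sup>2\<close> a nonnegative quadratic, whose discriminant is a negative multiple of Heron's product
  \<open>(s\<^sub>1+s\<^sub>2+s\<^sub>3)(s\<^sub>1+s\<^sub>2-s\<^sub>3)(s\<^sub>1-s\<^sub>2+s\<^sub>3)(-s\<^sub>1+s\<^sub>2+s\<^sub>3)\<close>; this requires \<open>s\<^sub>3 \<le> s\<^sub>1 + s\<^sub>2\<close>.\<close>

section \<open>Extrema on the closure of a bounded orbit\<close>

text \<open>No flow on the closure is needed: Taylor's formula on the orbit, with a remainder that is
  uniform by compactness, passes to the limit.\<close>

lemma max_principle:
  fixes u :: "'a::real_normed_vector \<Rightarrow> 'b::{real_normed_vector,heine_borel}"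
    and N N1 N2 :: "'b \<Rightarrow> real" and W :: "'b \<Rightarrow> 'b"
  assumes bdd: "bounded (range u)"
    and cont: "continuous_on UNIV N" "continuous_on UNIV N1" "continuous_on UNIV N2" "continuous_on UNIV W"
    and du: "\<And>z s. ((\<lambda>s. u (z + s *\<^sub>R d)) has_vector_derivative W (u (z + s *\<^sub>R d))) (at s)"
    and dN: "\<And>z s. ((\<lambda>s. N (u (z + s *\<^sub>R d))) has_real_derivative N1 (u (z + s *\<^sub>R d))) (at s)"
    and dN1: "\<And>z s. ((\<lambda>s. N1 (u (z + s *\<^sub>R d))) has_real_derivative N2 (u (z + s *\<^sub>R d))) (at s)"
    and y: "y \<in> closure (range u)" and max: "\<And>z. N (u z) \<le> N y"
  shows "N1 y = 0" "N2 y \<le> 0"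
proof -
  define K where "K = closure (range u)"
  have K: "compact K" unfolding K_def using bdd by (simp add: compact_closure)
  have uK: "u z \<in> K" for z unfolding K_def by (rule subsetD[OF closure_subset]) simp
  obtain v where v: "\<forall>n. v n \<in> range u" "v \<longlonglongrightarrow> y"
    using y[unfolded closure_sequential] by (elim exE conjE)
  from v(1) have "\<forall>n. \<exists>z. v n = u z" by (simp add: image_iff)
  from choice[OF this] obtain zs' where "\<forall>n. v n = u (zs' n)" by (elim exE)
  then have "v = (\<lambda>n. u (zs' n))" by (simp add: fun_eq_iff)
  with v(2) obtain zs where zs: "(\<lambda>n. u (zs n)) \<longlonglongrightarrow> y" by simp
  have lim: "(\<lambda>n. F (u (zs n))) \<longlonglongrightarrow> F y" if "continuous_on UNIV F" for F :: "'b \<Rightarrow> real"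
    using continuous_on_tendsto_compose[OF that zs] by simp
  \<comment> \<open>Order 2 Taylor expansion along the line in direction \<open>d\<close>, valid for
    both signs of \<open>s\<close>; the point \<open>\<xi>\<close> of the remainder stays within
    \<open>\<bar>s\<bar>\<close> of 0.\<close>
  have taylor: "\<exists>\<xi>. \<bar>\<xi>\<bar> \<le> \<bar>s\<bar> \<and> N (u (z + s *\<^sub>R d)) = N (u z) + N1 (u z) * s + N2 (u (z + \<xi> *\<^sub>R d)) / 2 * s\<^sup>2" for z s
  proof -
    define D where "D = (\<lambda>n::nat. if n = 0 then (\<lambda>s. N (u (z + s *\<^sub>R d)))
        else if n = 1 then (\<lambda>s. N1 (u (z + s *\<^sub>R d))) else (\<lambda>s. N2 (u (z + s *\<^sub>R d))))"
    have "\<exists>t. \<bar>t\<bar> \<le> \<bar>s\<bar> \<and> N (u (z + s *\<^sub>R d)) = (\<Sum>m<2. D m 0 / fact m * s ^ m) + D 2 t / fact 2 * s ^ 2"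
    proof (rule Maclaurin_bi_le)
      show "\<forall>m t. m < 2 \<and> \<bar>t\<bar> \<le> \<bar>s\<bar> \<longrightarrow> (D m has_real_derivative D (Suc m) t) (at t)"
      proof (intro allI impI)
        fix m :: nat and t assume "m < 2 \<and> \<bar>t\<bar> \<le> \<bar>s\<bar>"
        then consider "m = 0" | "m = 1" by linarith
        then show "(D m has_real_derivative D (Suc m) t) (at t)"
          by cases (use dN dN1 in \<open>auto simp: D_def\<close>)
      qed
    qed (simp add: D_def)
    then show ?thesis by (simp add: D_def numeral_2_eq_2)
  qed
  obtain B where B: "\<And>x. x \<in> K \<Longrightarrow> norm (W x) \<le> B"
    using compact_imp_bounded[OF compact_continuous_image[OF continuous_on_subset[OF cont(4)] K]]
    unfolding bounded_iff by blast
  obtain C where C: "\<And>x. x \<in> K \<Longrightarrow> \<bar>N2 x\<bar> \<le> C"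
    using compact_imp_bounded[OF compact_continuous_image[OF continuous_on_subset[OF cont(3)] K]]
    unfolding bounded_iff by auto
  \<comment> \<open>The velocity \<open>W\<close> is bounded on the compact set \<open>K\<close>, so
    the orbit moves at speed at most \<open>B\<close>.\<close>
  have lip: "norm (u (z + s *\<^sub>R d) - u z) \<le> B * \<bar>s\<bar>" for z s
  proof -
    have "norm (u (z + s *\<^sub>R d) - u (z + 0 *\<^sub>R d)) \<le> B * norm (s - 0)"
    proof (rule differentiable_bound[of UNIV _ "\<lambda>s h. h *\<^sub>R W (u (z + s *\<^sub>R d))"])
      show "onorm (\<lambda>h. h *\<^sub>R W (u (z + t *\<^sub>R d))) \<le> B" for t
        by (rule onorm_le) (use B[OF uK] in \<open>simp add: mult_left_mono mult.commute[of B]\<close>)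
    qed (use du in \<open>auto simp: has_vector_derivative_def\<close>)
    then show ?thesis by simp
  qed
  have first: "s * N1 y - C / 2 * s\<^sup>2 \<le> 0" for s
  proof -
    have "N (u (zs n)) + N1 (u (zs n)) * s - C / 2 * s\<^sup>2 \<le> N y" for n
    proof -
      obtain \<xi> where \<xi>: "N (u (zs n + s *\<^sub>R d)) = N (u (zs n)) + N1 (u (zs n)) * s + N2 (u (zs n + \<xi> *\<^sub>R d)) / 2 * s\<^sup>2"
        using taylor by blast
      have "- C / 2 * s\<^sup>2 \<le> N2 (u (zs n + \<xi> *\<^sub>R d)) / 2 * s\<^sup>2"
        using C[OF uK, of "zs n + \<xi> *\<^sub>R d"] by (intro mult_right_mono) auto
      with \<xi> max[of "zs n + s *\<^sub>R d"] show ?thesis by simp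
    qed
    moreover have "(\<lambda>n. N (u (zs n)) + N1 (u (zs n)) * s - C / 2 * s\<^sup>2) \<longlonglongrightarrow> N y + N1 y * s - C / 2 * s\<^sup>2"
      by (intro tendsto_intros lim cont)
    ultimately have "N y + N1 y * s - C / 2 * s\<^sup>2 \<le> N y"
      by (intro LIMSEQ_le_const2) auto
    then show ?thesis by (simp add: mult.commute)
  qed
  show N1: "N1 y = 0"
  proof (rule ccontr)
    assume nz: "N1 y \<noteq> 0"
    have Cpos: "C \<ge> 0" using C[OF uK, of "0"] by linarith
    \<comment> \<open>With \<open>s = N1 y * t\<close> and this small \<open>t\<close>, the linear
      term outweighs the quadratic one, contradicting \<open>first\<close>.\<close>
    define t where "t = 1 / (C + 1)"
    have t: "t > 0" "C * t < 1" using Cpos by (simp_all add: t_def)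
    have "N1 y * t * N1 y - C / 2 * (N1 y * t)\<^sup>2 = (N1 y)\<^sup>2 * t * (1 - C * t / 2)"
      by (simp add: algebra_simps power2_eq_square)
    moreover have "\<dots> > 0" using nz t by (intro mult_pos_pos) auto
    ultimately show False using first[of "N1 y * t"] by linarith
  qed
  show "N2 y \<le> 0"
  proof (rule field_le_epsilon)
    fix e :: real assume e: "e > 0"
    have "uniformly_continuous_on K N2"
      using compact_uniformly_continuous[OF continuous_on_subset[OF cont(3)] K] by simp
    then obtain \<delta> where \<delta>: "\<delta> > 0" "\<And>x x'. x \<in> K \<Longrightarrow> x' \<in> K \<Longrightarrow> dist x' x < \<delta> \<Longrightarrow> dist (N2 x') (N2 x) < e"
      using e unfolding uniformly_continuous_on_def by metis
    have Bpos: "B \<ge> 0" using B[OF uK, of 0] norm_ge_zero order_trans by blast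
    \<comment> \<open>This step is so short that the orbit moves by less than
      \<open>\<delta>\<close>, hence \<open>N2\<close> by less than \<open>e\<close>, uniformly in
      \<open>n\<close>.\<close>
    define s where "s = \<delta> / (B + 1)"
    have s: "s > 0" and Bs: "B * s < \<delta>" using \<delta>(1) Bpos by (auto simp: s_def field_simps)
    have "N (u (zs n)) + N1 (u (zs n)) * s + (N2 (u (zs n)) - e) / 2 * s\<^sup>2 \<le> N y" for n
    proof -
      obtain \<xi> where \<xi>: "\<bar>\<xi>\<bar> \<le> \<bar>s\<bar>" "N (u (zs n + s *\<^sub>R d)) = N (u (zs n)) + N1 (u (zs n)) * s + N2 (u (zs n + \<xi> *\<^sub>R d)) / 2 * s\<^sup>2"
        using taylor by blast
      have "B * \<bar>\<xi>\<bar> \<le> B * s" using \<xi>(1) s Bpos by (intro mult_left_mono) auto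
      then have "dist (u (zs n + \<xi> *\<^sub>R d)) (u (zs n)) < \<delta>"
        using lip[of "zs n" \<xi>] Bs by (simp add: dist_norm)
      then have "dist (N2 (u (zs n + \<xi> *\<^sub>R d))) (N2 (u (zs n))) < e" by (intro \<delta> uK)
      then have "(N2 (u (zs n)) - e) / 2 * s\<^sup>2 \<le> N2 (u (zs n + \<xi> *\<^sub>R d)) / 2 * s\<^sup>2"
        by (intro mult_right_mono) (auto simp: dist_real_def)
      with \<xi> max[of "zs n + s *\<^sub>R d"] show ?thesis by simp
    qed
    moreover have "(\<lambda>n. N (u (zs n)) + N1 (u (zs n)) * s + (N2 (u (zs n)) - e) / 2 * s\<^sup>2)
        \<longlonglongrightarrow> N y + N1 y * s + (N2 y - e) / 2 * s\<^sup>2"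
      by (intro tendsto_intros lim cont) auto
    ultimately have "N y + N1 y * s + (N2 y - e) / 2 * s\<^sup>2 \<le> N y"
      by (intro LIMSEQ_le_const2) auto
    then have "(N2 y - e) * s\<^sup>2 \<le> 0" using N1 by simp
    then have "N2 y - e \<le> 0" using s by (simp add: mult_le_0_iff)
    then show "N2 y \<le> 0 + e" by simp
  qed
qed

section \<open>Vanishing amplitude and Heron's product\<close>

text \<open>Below, \<open>F\<close> and \<open>H\<close> are twice the two lower coefficients of the cubic \<open>f\<close> matched to the three top
  coefficients of \<open>\<R>\<close>, whose last root pair is centred at \<open>0\<close>; the doubling avoids fractions.\<close>

lemma heron_identity:
  fixes x y s1 s2 s3 A B C k F H :: real
  assumes "A = x^2 + s1^2" "B = y^2 + s2^2" "C = s3^2" "k = - (x + y)"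
    "F = A + B + C + 4*x*y - k^2" "H = - 2*x*B - 2*y*A - 2*(x+y)*C - k*F"
  shows "16*((s1+s2+s3)*(s1+s2-s3)*(s1-s2+s3)*(-s1+s2+s3))*((y^2+s1^2)*(x^2+s2^2)*((x-y)^2+s3^2))
    = 4*(4*(A*B + (A+B+4*x*y)*C) - 4*k*H - F^2)*(4*(A*B*C) - H^2) - (4*((- 2*x*B - 2*y*A)*C) - 2*F*H)^2"
  unfolding assms by algebra

text \<open>Comparing coefficients turns the right-hand side of \<open>heron_identity\<close> into
  16 times \<open>4*e2*e0 - e1^2\<close>, which is nonnegative by \<open>disc\<close>; the cofactor
  of Heron's product is positive.\<close>

lemma heron_nonneg_centred:
  fixes x y s1 s2 s3 :: real
  assumes eq: "\<And>l::real. (l^3 + k*l^2 + f1*l + h)^2 + (e2*l^2 + e1*l + e0)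
      = ((l-x)^2 + s1^2) * ((l-y)^2 + s2^2) * (l^2 + s3^2)"
    and disc: "e1^2 \<le> 4*e2*e0" and s: "s1 > 0" "s2 > 0" "s3 > 0"
  shows "(s1+s2+s3)*(s1+s2-s3)*(s1-s2+s3)*(-s1+s2+s3) \<ge> 0"
proof -
  define A where "A = x^2+s1^2"
  define B where "B = y^2+s2^2"
  define C where "C = s3^2"
  have "poly [:h^2+e0, 2*f1*h+e1, f1^2+2*k*h+e2, 2*h+2*k*f1, k^2+2*f1, 2*k, 1:] l
      = poly [:A*B*C, (-2*x*B - 2*y*A)*C, A*B + (A+B+4*x*y)*C, -2*x*B - 2*y*A - 2*(x+y)*C,
          A + B + C + 4*x*y, -2*(x+y), 1:] l" for l
    using eq[of l] unfolding A_def B_def C_def by (simp add: algebra_simps power2_eq_square power3_eq_cube)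
  then have "[:h^2+e0, 2*f1*h+e1, f1^2+2*k*h+e2, 2*h+2*k*f1, k^2+2*f1, 2*k, 1:]
      = [:A*B*C, (-2*x*B - 2*y*A)*C, A*B + (A+B+4*x*y)*C, -2*x*B - 2*y*A - 2*(x+y)*C,
          A + B + C + 4*x*y, -2*(x+y), 1:]"
    by (simp only: poly_eq_poly_eq_iff[symmetric] fun_eq_iff) simp
  then have k: "k = -(x+y)" and co': "h^2+e0 = A*B*C" "2*f1*h+e1 = (-2*x*B - 2*y*A)*C"
     "f1^2+2*k*h+e2 = A*B + (A+B+4*x*y)*C" "2*h+2*k*f1 = -2*x*B - 2*y*A - 2*(x+y)*C" "k^2+2*f1 = A + B + C + 4*x*y"
    unfolding pCons_eq_iff by (elim conjE; simp)+
  \<comment> \<open>The instance \<open>F = 2*f1\<close>, \<open>H = 2*h\<close>.\<close>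
  have "16*((s1+s2+s3)*(s1+s2-s3)*(s1-s2+s3)*(-s1+s2+s3))*((y^2+s1^2)*(x^2+s2^2)*((x-y)^2+s3^2))
      = 4*(4*(A*B + (A+B+4*x*y)*C) - 4*k*(2*h) - (2*f1)^2)*(4*(A*B*C) - (2*h)^2)
        - (4*((- 2*x*B - 2*y*A)*C) - 2*(2*f1)*(2*h))^2"
    by (rule heron_identity[OF A_def B_def C_def k]) (use co' in \<open>simp_all add: algebra_simps\<close>)
  also have "\<dots> = 16 * (4*e2*e0 - e1^2)"
    unfolding co'[symmetric] by (simp add: power2_eq_square algebra_simps)
  also have "\<dots> \<ge> 0" by (rule mult_nonneg_nonneg) (use disc in \<open>simp_all only: diff_ge_0_iff_ge zero_le_numeral\<close>)
  finally show ?thesis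
    using s by (simp add: zero_le_mult_iff add_nonneg_pos not_less) (smt (verit) zero_less_power zero_le_power2 mult_pos_pos)
qed

text \<open>Translating by \<open>r3\<close> centres the last root pair at 0, and the discriminant
  of a quadratic is invariant under translation.\<close>

lemma heron_nonneg:
  fixes r1 r2 r3 s1 s2 s3 :: real
  assumes eq: "\<And>l::real. (l^3 + k*l^2 + f1*l + h)^2 + (e2*l^2 + e1*l + e0)
      = ((l-r1)^2 + s1^2) * ((l-r2)^2 + s2^2) * ((l-r3)^2 + s3^2)"
    and disc: "e1^2 \<le> 4*e2*e0" and s: "s1 > 0" "s2 > 0" "s3 > 0"
  shows "(s1+s2+s3)*(s1+s2-s3)*(s1-s2+s3)*(-s1+s2+s3) \<ge> 0"
proof (rule heron_nonneg_centred)
  show "(l^3 + (k+3*r3)*l^2 + (f1+2*k*r3+3*r3^2)*l + (h+f1*r3+k*r3^2+r3^3))^2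
      + (e2*l^2 + (e1+2*e2*r3)*l + (e0+e1*r3+e2*r3^2))
      = ((l-(r1-r3))^2 + s1^2) * ((l-(r2-r3))^2 + s2^2) * (l^2 + s3^2)" for l
  proof -
    have "l^3 + (k+3*r3)*l^2 + (f1+2*k*r3+3*r3^2)*l + (h+f1*r3+k*r3^2+r3^3)
      = (l+r3)^3 + k*(l+r3)^2 + f1*(l+r3) + h"
      by (simp add: algebra_simps power2_eq_square power3_eq_cube)
    moreover have "e2*l^2 + (e1+2*e2*r3)*l + (e0+e1*r3+e2*r3^2) = e2*(l+r3)^2 + e1*(l+r3) + e0"
      by (simp add: algebra_simps power2_eq_square)
    ultimately show ?thesis using eq[of "l+r3"] by (simp add: algebra_simps)
  qed
  show "(e1+2*e2*r3)^2 \<le> 4*e2*(e0+e1*r3+e2*r3^2)"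
    using disc by (simp add: algebra_simps power2_eq_square)
qed (fact s)+

section \<open>The resultant at a critical point\<close>

text \<open>Subtracting the root equations and cancelling differences of distinct roots gives
  Vieta's relations in any integral domain.\<close>

lemma monic_cubic_factor:
  fixes z1 z2 z3 :: "'a::idom"
  assumes "z1^3 + A*z1^2 + B*z1 + C = 0" "z2^3 + A*z2^2 + B*z2 + C = 0" "z3^3 + A*z3^2 + B*z3 + C = 0"
    and d: "z1 \<noteq> z2" "z1 \<noteq> z3" "z2 \<noteq> z3"
  shows "A = - (z1 + z2 + z3)" "l^3 + A*l^2 + B*l + C = (l-z1)*(l-z2)*(l-z3)"
proof -
  have "(z1-z2) * (z1^2+z1*z2+z2^2+A*(z1+z2)+B) = 0" using assms by algebra
  then have 1: "z1^2+z1*z2+z2^2+A*(z1+z2)+B = 0" using d by simp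
  have "(z1-z3) * (z1^2+z1*z3+z3^2+A*(z1+z3)+B) = 0" using assms by algebra
  then have 2: "z1^2+z1*z3+z3^2+A*(z1+z3)+B = 0" using d by simp
  have "(z2-z3) * (z1+z2+z3+A) = 0" using 1 2 by algebra
  then have 3: "z1+z2+z3+A = 0" using d by simp
  then show "A = - (z1 + z2 + z3)" by algebra
  show "l^3 + A*l^2 + B*l + C = (l-z1)*(l-z2)*(l-z3)" using 1 3 assms(1) by algebra
qed

text \<open>Here \<open>a \<lambda> + b\<close> is the remainder of \<open>f\<close> modulo \<open>m = \<lambda>\<^sup>2 + m\<^sub>1 \<lambda> + m\<^sub>0\<close>, so that
  \<open>a\<^sup>2 m\<^sub>0 - a b m\<^sub>1 + b\<^sup>2\<close> is the product of \<open>f\<close> over the roots of \<open>m\<close>. At a root \<open>z\<close> of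
  \<open>g = f + \<i>\<kappa>m\<close> one has \<open>2\<i>\<kappa> m(z) = - (z - z\<^sub>1\<^sup>*)(z - z\<^sub>2\<^sup>*)(z - z\<^sub>3\<^sup>*)\<close>.\<close>

lemma critical_discriminant:
  fixes c2 f1 h \<kappa> m1 m0 a b :: real and v1 v2 v3 :: complex
  assumes R: "\<And>l::complex. (l^3 + c2*l^2 + f1*l + h)^2 + \<kappa>^2*(l^2 + m1*l + m0)^2
      = (l-v1)*(l-cnj v1)*(l-v2)*(l-cnj v2)*(l-v3)*(l-cnj v3)"
    and d: "v1 \<noteq> v2" "v1 \<noteq> cnj v2" "v1 \<noteq> v3" "v1 \<noteq> cnj v3" "v2 \<noteq> v3" "v2 \<noteq> cnj v3"
    and a: "a = f1 - m0 - c2*m1 + m1^2" and b: "b = h - c2*m0 + m1*m0"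
  shows "\<exists>e1 e2 e3 D. e1 \<in> {Im v1, - Im v1} \<and> e2 \<in> {Im v2, - Im v2} \<and> e3 \<in> {Im v3, - Im v3}
    \<and> \<kappa> = e1 + e2 + e3 \<and> D > 0 \<and> \<kappa>^3 * (a^2*m0 - a*b*m1 + b^2) = - (e1*e2*e3*D)"
proof -
  \<comment> \<open>The lower coefficients of \<open>g = f + i \<kappa> m\<close>; the spectral
    polynomial is then \<open>g\<close> times its conjugate polynomial.\<close>
  define A B C where "A = Complex c2 \<kappa>" and "B = Complex f1 (\<kappa>*m1)" and "C = Complex h (\<kappa>*m0)"
  have ABC: "A = c2 + \<i>*\<kappa>" "B = f1 + \<i>*\<kappa>*m1" "C = h + \<i>*\<kappa>*m0"
    by (simp_all add: A_def B_def C_def complex_eq_iff)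
  define g where "g l = l^3 + A*l^2 + B*l + C" for l
  have gg: "g l * cnj (g (cnj l)) = (l-v1)*(l-cnj v1)*(l-v2)*(l-cnj v2)*(l-v3)*(l-cnj v3)" for l
    unfolding R[symmetric] g_def ABC by (simp add: algebra_simps power2_eq_square power3_eq_cube)
  have root: "\<exists>z. z \<in> {v, cnj v} \<and> g z = 0" if "v \<in> {v1,v2,v3}" for v
  proof -
    have "g v * cnj (g (cnj v)) = 0" unfolding gg using that by auto
    then show ?thesis by auto
  qed
  obtain z1 where z1: "z1 \<in> {v1, cnj v1}" "g z1 = 0" using root by blast
  obtain z2 where z2: "z2 \<in> {v2, cnj v2}" "g z2 = 0" using root by blast
  obtain z3 where z3: "z3 \<in> {v3, cnj v3}" "g z3 = 0" using root by blast
  \<comment> \<open>The inequalities against conjugates are what makes \<open>D\<close> positive at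
    the end.\<close>
  have dz: "z1 \<noteq> z2" "z1 \<noteq> z3" "z2 \<noteq> z3" "z1 \<noteq> cnj z2" "z1 \<noteq> cnj z3" "z2 \<noteq> cnj z3"
    using z1(1) z2(1) z3(1) d by (auto simp: complex_cnj_cancel_iff dest: arg_cong[where f=cnj])
  note fac = monic_cubic_factor[OF z1(2)[unfolded g_def] z2(2)[unfolded g_def] z3(2)[unfolded g_def] dz(1-3)]
  have g: "g l = (l-z1)*(l-z2)*(l-z3)" for l unfolding g_def by (rule fac(2))
  have gc: "cnj (g (cnj l)) = (l-cnj z1)*(l-cnj z2)*(l-cnj z3)" for l unfolding g by simp
  define \<mu> where "\<mu> = (- m1 + csqrt (m1^2 - 4*m0)) / 2"
  define \<mu>' where "\<mu>' = (- m1 - csqrt (m1^2 - 4*m0)) / 2"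
  have m1: "complex_of_real m1 = - (\<mu> + \<mu>')" by (simp add: \<mu>_def \<mu>'_def field_simps)
  have "4 * (\<mu> * \<mu>') = m1^2 - (csqrt (m1^2 - 4*m0))^2"
    unfolding \<mu>_def \<mu>'_def by (simp add: field_simps power2_eq_square)
  then have m0: "complex_of_real m0 = \<mu> * \<mu>'" by simp
  have m: "2*\<i>*\<kappa> * ((l-\<mu>)*(l-\<mu>')) = g l - cnj (g (cnj l))" for l
  proof -
    have "(l-\<mu>)*(l-\<mu>') = l^2 + m1*l + m0" unfolding m1 m0 by (simp add: algebra_simps power2_eq_square)
    then show ?thesis unfolding g_def ABC by (simp add: algebra_simps)
  qed
  have at_root: "2*\<i>*\<kappa> * ((z-\<mu>)*(z-\<mu>')) = - ((z-cnj z1)*(z-cnj z2)*(z-cnj z3))" if "g z = 0" for z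
    using m[of z] that unfolding gc by simp
  have rem: "a*x + b = (x-z1)*(x-z2)*(x-z3)" if "x \<in> {\<mu>, \<mu>'}" for x :: complex
  proof -
    have "x^2 + m1*x + m0 = 0" using that unfolding m1 m0 by (auto simp: algebra_simps power2_eq_square)
    then have "g x = a*x + b" unfolding g_def ABC a b of_real_add of_real_diff of_real_mult of_real_power by algebra
    then show ?thesis by (simp add: g)
  qed
  define \<Delta> where "\<Delta> = a^2*m0 - a*b*m1 + b^2"
  \<comment> \<open>The resultant is read in two ways: as the product of \<open>f\<close> over the
    roots of \<open>m\<close>, where \<open>f\<close> and \<open>g\<close> agree, and as the product
    of \<open>m\<close> over the roots of \<open>g\<close>.\<close>
  have "complex_of_real \<Delta> = (a*\<mu>+b)*(a*\<mu>'+b)"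
    unfolding \<Delta>_def of_real_add of_real_diff of_real_mult of_real_power m1 m0 by algebra
  also have "\<dots> = ((\<mu>-z1)*(\<mu>-z2)*(\<mu>-z3)) * ((\<mu>'-z1)*(\<mu>'-z2)*(\<mu>'-z3))"
    using rem by simp
  also have "\<dots> = ((z1-\<mu>)*(z1-\<mu>'))*((z2-\<mu>)*(z2-\<mu>'))*((z3-\<mu>)*(z3-\<mu>'))"
    by algebra
  finally have \<Delta>: "complex_of_real \<Delta> = ((z1-\<mu>)*(z1-\<mu>'))*((z2-\<mu>)*(z2-\<mu>'))*((z3-\<mu>)*(z3-\<mu>'))" .
  have pair: "(z-cnj w)*(w-cnj z) = - complex_of_real ((cmod (z - cnj w))\<^sup>2)" for z w
    unfolding complex_norm_square by (simp add: algebra_simps)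
  have "(2*\<i>*\<kappa>)^3 * \<Delta> = (2*\<i>*\<kappa>*((z1-\<mu>)*(z1-\<mu>')))*(2*\<i>*\<kappa>*((z2-\<mu>)*(z2-\<mu>')))*(2*\<i>*\<kappa>*((z3-\<mu>)*(z3-\<mu>')))"
    unfolding \<Delta> by algebra
  \<comment> \<open>Of the nine factors from \<open>at_root\<close>, three are
    \<open>z_j - cnj z_j\<close>; by \<open>pair\<close> the other six combine into three negated
    squared distances.\<close>
  also have "\<dots> = - (((z1-cnj z1)*(z2-cnj z2)*(z3-cnj z3)) * ((z1-cnj z2)*(z2-cnj z1))
      * ((z1-cnj z3)*(z3-cnj z1)) * ((z2-cnj z3)*(z3-cnj z2)))"
    unfolding at_root[OF z1(2)] at_root[OF z2(2)] at_root[OF z3(2)] by (simp add: mult_ac)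
  also have "\<dots> = - (8*\<i>) * complex_of_real (Im z1*Im z2*Im z3 * ((cmod (z1 - cnj z2))\<^sup>2*(cmod (z1 - cnj z3))\<^sup>2*(cmod (z2 - cnj z3))\<^sup>2))"
    unfolding pair by (simp add: complex_diff_cnj mult_ac)
  finally have "(2*\<i>*\<kappa>)^3 * \<Delta> = - (8*\<i>) * complex_of_real (Im z1*Im z2*Im z3 * ((cmod (z1 - cnj z2))\<^sup>2*(cmod (z1 - cnj z3))\<^sup>2*(cmod (z2 - cnj z3))\<^sup>2))" .
  moreover have "(2*\<i>*\<kappa>)^3 * \<Delta> = - (8*\<i>) * complex_of_real (\<kappa>^3 * \<Delta>)"
    by (simp add: power3_eq_cube)
  ultimately have "complex_of_real (\<kappa>^3 * \<Delta>) = complex_of_real (Im z1*Im z2*Im z3 * ((cmod (z1 - cnj z2))\<^sup>2*(cmod (z1 - cnj z3))\<^sup>2*(cmod (z2 - cnj z3))\<^sup>2))"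
    by (metis mult_cancel_left neg_equal_0_iff_equal complex_i_not_zero mult_eq_0_iff zero_neq_numeral)
  then have main: "\<kappa>^3 * \<Delta> = - ((- Im z1)*(- Im z2)*(- Im z3) * ((cmod (z1 - cnj z2))\<^sup>2*(cmod (z1 - cnj z3))\<^sup>2*(cmod (z2 - cnj z3))\<^sup>2))"
    by (simp add: of_real_eq_iff del: of_real_mult of_real_power)
  \<comment> \<open>The signs are fixed by \<open>e_j = - Im z_j\<close>, because the roots of
    \<open>g\<close> sum to \<open>- A\<close> and \<open>Im A = \<kappa>\<close>.\<close>
  have "\<kappa> = - Im z1 + - Im z2 + - Im z3" using arg_cong[OF fac(1), of Im] by (simp add: A_def)
  moreover have "(cmod (z1 - cnj z2))\<^sup>2*(cmod (z1 - cnj z3))\<^sup>2*(cmod (z2 - cnj z3))\<^sup>2 > 0"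
    using dz by simp
  moreover have "- Im z1 \<in> {Im v1, - Im v1}" "- Im z2 \<in> {Im v2, - Im v2}" "- Im z3 \<in> {Im v3, - Im v3}"
    using z1(1) z2(1) z3(1) by auto
  ultimately show ?thesis using main unfolding \<Delta>_def by blast
qed

section \<open>The Lax pair as a flow on the coefficients\<close>

lemma dx_has_derivative:
  assumes "(f has_derivative D) (at z)"
  shows "dx f z = D (1, 0)"
proof -
  obtain x t where z: "z = (x, t)" by (cases z)
  interpret bounded_linear D using assms by (rule has_derivative_bounded_linear)
  have "((\<lambda>y. f (y, t)) has_derivative (\<lambda>h. D (h, 0))) (at x)"
    by (rule has_derivative_compose[of "\<lambda>y. (y, t)"])
      (use assms z in \<open>auto intro!: derivative_eq_intros\<close>)
  moreover have "(\<lambda>h. D (h, 0)) = (\<lambda>h. h *\<^sub>R D (1, 0))"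
    by (simp add: scaleR[symmetric])
  ultimately have "((\<lambda>y. f (y, t)) has_vector_derivative D (1, 0)) (at x)"
    by (simp only: has_vector_derivative_def)
  then show ?thesis by (simp add: dx_def z vector_derivative_at)
qed

lemma dt_has_derivative:
  assumes "(f has_derivative D) (at z)"
  shows "dt f z = D (0, 1)"
proof -
  obtain x t where z: "z = (x, t)" by (cases z)
  interpret bounded_linear D using assms by (rule has_derivative_bounded_linear)
  have "((\<lambda>s. f (x, s)) has_derivative (\<lambda>h. D (0, h))) (at t)"
    by (rule has_derivative_compose[of "\<lambda>s. (x, s)"])
      (use assms z in \<open>auto intro!: derivative_eq_intros\<close>)
  moreover have "(\<lambda>h. D (0, h)) = (\<lambda>h. h *\<^sub>R D (0, 1))"
    by (simp add: scaleR[symmetric])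
  ultimately have "((\<lambda>s. f (x, s)) has_vector_derivative D (0, 1)) (at t)"
    by (simp only: has_vector_derivative_def)
  then show ?thesis by (simp add: dt_def z vector_derivative_at)
qed

lemma has_vector_derivative_along_line:
  assumes "f differentiable at (z + s *\<^sub>R d)"
  shows "((\<lambda>s. f (z + s *\<^sub>R d)) has_vector_derivative
    (fst d *\<^sub>R dx f (z + s *\<^sub>R d) + snd d *\<^sub>R dt f (z + s *\<^sub>R d))) (at s)"
proof -
  obtain D where D: "(f has_derivative D) (at (z + s *\<^sub>R d))"
    using assms unfolding differentiable_def by blast
  interpret bounded_linear D using D by (rule has_derivative_bounded_linear)
  have "d = fst d *\<^sub>R (1, 0) + snd d *\<^sub>R (0, 1)" by (simp add: prod_eq_iff)
  then have Dd: "D d = fst d *\<^sub>R D (1, 0) + snd d *\<^sub>R D (0, 1)" by (metis add scaleR)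
  have "((\<lambda>s. f (z + s *\<^sub>R d)) has_derivative (\<lambda>h. D (h *\<^sub>R d))) (at s)"
    by (rule has_derivative_compose[of "\<lambda>s. z + s *\<^sub>R d"])
      (use D in \<open>auto intro!: derivative_eq_intros\<close>)
  then show ?thesis
    by (simp add: has_vector_derivative_def scaleR dx_has_derivative[OF D] dt_has_derivative[OF D] Dd)
qed

lemma dx_cnj:
  assumes "f differentiable at z"
  shows "dx (\<lambda>w. cnj (f w)) z = cnj (dx f z)"
proof -
  obtain D where D: "(f has_derivative D) (at z)"
    using assms unfolding differentiable_def by blast
  have "((\<lambda>w. cnj (f w)) has_derivative (\<lambda>h. cnj (D h))) (at z)"
    by (rule bounded_linear.has_derivative[OF bounded_linear_cnj D])
  then show ?thesis by (simp add: dx_has_derivative[OF D] dx_has_derivative)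
qed

lemma smooth2_differentiable:
  fixes p :: "real \<times> real \<Rightarrow> complex"
  assumes "smooth2 p"
  shows "p differentiable at z" "dx p differentiable at z" "dx (dx p) differentiable at z"
  using assms[unfolded smooth2_def, rule_format, of "[]" z]
    assms[unfolded smooth2_def, rule_format, of "[True]" z]
    assms[unfolded smooth2_def, rule_format, of "[True, True]" z] by simp_all

text \<open>With \<open>P = p\<close>, the two functions below are the lower coefficients in
  \<open>\<Psi>\<^sub>1\<^sub>2 = \<i>(P \<lambda>\<^sup>2 + Q \<lambda> + W)\<close>, and \<^term>\<open>hcoef\<close> is the constant coefficient of \<open>\<i>\<Psi>\<^sub>1\<^sub>1\<close>.\<close>

definition Qcoef :: "(real \<times> real \<Rightarrow> complex) \<Rightarrow> real \<Rightarrow> real \<times> real \<Rightarrow> complex" where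
  "Qcoef p c2 z = \<i> / 2 * dx p z + c2 * p z"

definition Wcoef :: "(real \<times> real \<Rightarrow> complex) \<Rightarrow> real \<Rightarrow> real \<Rightarrow> real \<times> real \<Rightarrow> complex" where
  "Wcoef p c1 c2 z = - dx (dx p) z / 4 - p z * sqabs p z / 2 + \<i> / 2 * c2 * dx p z + c1 * p z"

definition hcoef :: "real \<Rightarrow> real \<Rightarrow> complex \<Rightarrow> complex \<Rightarrow> real" where
  "hcoef c0 c2 P Q = c0 + c2 / 2 * (cmod P)\<^sup>2 - Re (P * cnj Q)"

text \<open>Real coefficients on the diagonal and mutually conjugate ones off it: for real
  \<open>l\<close> the spectral polynomial becomes a sum of two squared moduli, which later bounds
  the orbit.\<close>

lemma Psi_coefficients:
  fixes p :: "real \<times> real \<Rightarrow> complex"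
  assumes "smooth2 p"
  shows "Psi11 p c0 c1 c2 l z = - \<i> * (l^3 + c2 * l\<^sup>2 + complex_of_real (c1 - (cmod (p z))\<^sup>2 / 2) * l
      + hcoef c0 c2 (p z) (Qcoef p c2 z))" (is ?A)
    and "Psi12 p c0 c1 c2 l z = \<i> * (p z * l\<^sup>2 + Qcoef p c2 z * l + Wcoef p c1 c2 z)" (is ?B)
    and "Psi21 p c0 c1 c2 l z = \<i> * (cnj (p z) * l\<^sup>2 + cnj (Qcoef p c2 z) * l + cnj (Wcoef p c1 c2 z))" (is ?C)
proof -
  note diff = smooth2_differentiable[OF assms]
  have c1: "dx (\<lambda>w. cnj (p w)) = (\<lambda>w. cnj (dx p w))" by (rule ext) (rule dx_cnj[OF diff(1)])
  have c2: "dx (\<lambda>w. cnj (dx p w)) = (\<lambda>w. cnj (dx (dx p) w))" by (rule ext) (rule dx_cnj[OF diff(2)])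
  have h: "complex_of_real (hcoef c0 c2 (p z) (Qcoef p c2 z))
     = c0 - c2 / 2 * sqabs p z + \<i> / 4 * (p z * cnj (dx p z) - dx p z * cnj (p z))"
    unfolding hcoef_def Qcoef_def sqabs_def cmod_power2
    by (simp add: complex_eq_iff field_simps power2_eq_square)
  show ?A unfolding h Psi11_def c1 by (simp add: sqabs_def algebra_simps add_divide_distrib diff_divide_distrib)
  show ?B unfolding Psi12_def Qcoef_def Wcoef_def by (simp add: algebra_simps)
  show ?C unfolding Psi21_def c1 c2 Qcoef_def Wcoef_def by (simp add: sqabs_def algebra_simps)
qed

lemma Qcoef_Wcoef_differentiable:
  fixes p :: "real \<times> real \<Rightarrow> complex"
  assumes "smooth2 p"
  shows "Qcoef p c2 differentiable at z" "Wcoef p c1 c2 differentiable at z"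
proof -
  note diff = smooth2_differentiable[OF assms]
  show "Qcoef p c2 differentiable at z"
    unfolding Qcoef_def[abs_def] by (intro derivative_intros diff)
  have "(\<lambda>z. cnj (p z)) differentiable at z"
    using diff(1)[of z] bounded_linear.has_derivative[OF bounded_linear_cnj]
    unfolding differentiable_def by blast
  then show "Wcoef p c1 c2 differentiable at z"
    unfolding Wcoef_def[abs_def] sqabs_def complex_norm_square
    by (intro derivative_intros diff) auto
qed

section \<open>Evolution of the coefficients of \<open>Psi12\<close>\<close>

lemma dx_dt_Psi12:
  fixes p :: "real \<times> real \<Rightarrow> complex"
  assumes "smooth2 p"
  shows "dx (Psi12 p c0 c1 c2 l) z = \<i> * (dx p z * l\<^sup>2 + dx (Qcoef p c2) z * l + dx (Wcoef p c1 c2) z)"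
    and "dt (Psi12 p c0 c1 c2 l) z = \<i> * (dt p z * l\<^sup>2 + dt (Qcoef p c2) z * l + dt (Wcoef p c1 c2) z)"
proof -
  note diff = smooth2_differentiable(1)[OF assms, of z] Qcoef_Wcoef_differentiable(1)[OF assms, of c2 z]
    Qcoef_Wcoef_differentiable(2)[OF assms, of c1 c2 z]
  obtain DP DQ DW where D: "(p has_derivative DP) (at z)" "(Qcoef p c2 has_derivative DQ) (at z)"
      "(Wcoef p c1 c2 has_derivative DW) (at z)"
    using diff unfolding differentiable_def by blast
  have "Psi12 p c0 c1 c2 l = (\<lambda>z. \<i> * (p z * l\<^sup>2 + Qcoef p c2 z * l + Wcoef p c1 c2 z))"
    by (rule ext) (rule Psi_coefficients(2)[OF assms])
  then have "(Psi12 p c0 c1 c2 l has_derivative (\<lambda>h. \<i> * (DP h * l\<^sup>2 + DQ h * l + DW h))) (at z)"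
    by (auto intro!: derivative_eq_intros D)
  from dx_has_derivative[OF this] dt_has_derivative[OF this]
  show "dx (Psi12 p c0 c1 c2 l) z = \<i> * (dx p z * l\<^sup>2 + dx (Qcoef p c2) z * l + dx (Wcoef p c1 c2) z)"
    "dt (Psi12 p c0 c1 c2 l) z = \<i> * (dt p z * l\<^sup>2 + dt (Qcoef p c2) z * l + dt (Wcoef p c1 c2) z)"
    by (simp_all add: D[THEN dx_has_derivative] D[THEN dt_has_derivative])
qed

lemma two_phase_Psi12:
  fixes p :: "real \<times> real \<Rightarrow> complex"
  assumes "two_phase p c0 c1 c2"
  shows "dx (Psi12 p c0 c1 c2 l) z = - 2 * \<i> * l * Psi12 p c0 c1 c2 l z - 2 * \<i> * p z * Psi11 p c0 c1 c2 l z"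
    and "dt (Psi12 p c0 c1 c2 l) z = 2 * (- 2 * \<i> * l\<^sup>2 + \<i> * sqabs p z) * Psi12 p c0 c1 c2 l z
      - 2 * (2 * \<i> * l * p z - dx p z) * Psi11 p c0 c1 c2 l z"
proof -
  have "mdx (Psi p c0 c1 c2 l) z = commutator (laxU p l z) (Psi p c0 c1 c2 l z)"
    using assms unfolding two_phase_def by blast
  from arg_cong[OF this, of "\<lambda>M. M $ 1 $ 2"]
  show "dx (Psi12 p c0 c1 c2 l) z = - 2 * \<i> * l * Psi12 p c0 c1 c2 l z - 2 * \<i> * p z * Psi11 p c0 c1 c2 l z"
    unfolding mdx_def commutator_def Psi_def laxU_def mat2_def matrix_matrix_mult_def
    by (simp add: sum_2 algebra_simps)
  have "mdt (Psi p c0 c1 c2 l) z = commutator (laxV p l z) (Psi p c0 c1 c2 l z)"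
    using assms unfolding two_phase_def by blast
  from arg_cong[OF this, of "\<lambda>M. M $ 1 $ 2"]
  show "dt (Psi12 p c0 c1 c2 l) z = 2 * (- 2 * \<i> * l\<^sup>2 + \<i> * sqabs p z) * Psi12 p c0 c1 c2 l z
      - 2 * (2 * \<i> * l * p z - dx p z) * Psi11 p c0 c1 c2 l z"
    unfolding mdt_def commutator_def Psi_def laxV_def mat2_def matrix_matrix_mult_def
    by (simp add: sum_2 algebra_simps)
qed

lemma spectral_R_coefficients:
  fixes p :: "real \<times> real \<Rightarrow> complex"
  assumes "smooth2 p"
  shows "spectral_R p c0 c1 c2 l z
    = (l^3 + c2 * l\<^sup>2 + complex_of_real (c1 - (cmod (p z))\<^sup>2 / 2) * l + hcoef c0 c2 (p z) (Qcoef p c2 z))\<^sup>2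
      + (p z * l\<^sup>2 + Qcoef p c2 z * l + Wcoef p c1 c2 z)
        * (cnj (p z) * l\<^sup>2 + cnj (Qcoef p c2 z) * l + cnj (Wcoef p c1 c2 z))"
proof -
  have *: "- (- \<i> * f)\<^sup>2 - \<i> * m * (\<i> * m') = f\<^sup>2 + m * m'" for f m m' :: complex
    by (simp add: power2_eq_square algebra_simps)
  show ?thesis unfolding spectral_R_def Psi_coefficients[OF assms] by (rule *)
qed

text \<open>Both sides are polynomials in \<open>l\<close>, so evaluation at 0 and 1 for the
  x-equation, and at 0, 1 and -1 for the t-equation, isolates the coefficients. Here
  \<open>n\<close> stands for the squared amplitude.\<close>

lemma lax_flow_coefficients:
  fixes Px Qx Wx Pt Qt Wt P Q W c1 c2 f1 h n :: complex
  assumes X: "\<And>l. \<i> * (Px * l\<^sup>2 + Qx * l + Wx) = - 2 * \<i> * l * (\<i> * (P * l\<^sup>2 + Q * l + W))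
      - 2 * \<i> * P * (- \<i> * (l^3 + c2 * l\<^sup>2 + f1 * l + h))"
    and T: "\<And>l. \<i> * (Pt * l\<^sup>2 + Qt * l + Wt) = 2 * (- 2 * \<i> * l\<^sup>2 + \<i> * n) * (\<i> * (P * l\<^sup>2 + Q * l + W))
      - 2 * (2 * \<i> * l * P - Px) * (- \<i> * (l^3 + c2 * l\<^sup>2 + f1 * l + h))"
    and Px: "Px = 2 * \<i> * (c2 * P - Q)" and n: "n = 2 * c1 - 2 * f1"
  shows "Qx = 2 * \<i> * (f1 * P - W)" "Wx = 2 * \<i> * h * P"
    "Pt + 2 * c2 * Px = 4 * \<i> * (c1 * P - W)"
    "Qt + 2 * c2 * Qx = 4 * \<i> * (h * P + c1 * Q - c2 * W)"
    "Wt + 2 * c2 * Wx = 2 * \<i> * n * W + 4 * \<i> * h * Q"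
proof -
  have i: "a = b" if "\<i> * a = \<i> * b" for a b using that by simp
  have X': "Px * l\<^sup>2 + Qx * l + Wx = - 2 * \<i> * l * (P * l\<^sup>2 + Q * l + W)
      + 2 * \<i> * P * (l^3 + c2 * l\<^sup>2 + f1 * l + h)" for l
    by (rule i, subst X) algebra
  have T': "Pt * l\<^sup>2 + Qt * l + Wt = 2 * \<i> * (n - 2 * l\<^sup>2) * (P * l\<^sup>2 + Q * l + W)
      + 2 * (2 * \<i> * l * P - Px) * (l^3 + c2 * l\<^sup>2 + f1 * l + h)" for l
    by (rule i, subst T) algebra
  show Wx: "Wx = 2 * \<i> * h * P" using X'[of 0] by simp
  have "Px + Qx + Wx = - 2 * \<i> * (P + Q + W) + 2 * \<i> * P * (1 + c2 + f1 + h)" using X'[of 1] by simp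
  then show Qx: "Qx = 2 * \<i> * (f1 * P - W)" unfolding Px Wx by algebra
  have Wt: "Wt = 2 * \<i> * n * W - 2 * Px * h" using T'[of 0] by simp
  have t1: "Pt + Qt + Wt = 2 * \<i> * (n - 2) * (P + Q + W) + 2 * (2 * \<i> * P - Px) * (1 + c2 + f1 + h)"
    using T'[of 1] by simp
  have t2: "Pt - Qt + Wt = 2 * \<i> * (n - 2) * (P - Q + W) + 2 * (- 2 * \<i> * P - Px) * (- 1 + c2 - f1 + h)"
    using T'[of "-1"] by simp
  show "Pt + 2 * c2 * Px = 4 * \<i> * (c1 * P - W)"
    using t1 t2 unfolding Wt Px n by algebra
  show "Qt + 2 * c2 * Qx = 4 * \<i> * (h * P + c1 * Q - c2 * W)"
    using t1 t2 unfolding Wt Px Qx n by algebra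
  show "Wt + 2 * c2 * Wx = 2 * \<i> * n * W + 4 * \<i> * h * Q"
    unfolding Wt Wx Px by algebra
qed

text \<open>The first equation inverts the definition of \<open>Qcoef\<close>, the others come from
  the Lax pair. The system closes in the triple \<open>(P, Q, W)\<close>, so its right-hand sides
  make sense at limit points of the orbit.\<close>

lemma flow_equations:
  fixes p :: "real \<times> real \<Rightarrow> complex"
  assumes sm: "smooth2 p" and tp: "two_phase p c0 c1 c2"
  shows "dx p z = 2 * \<i> * (c2 * p z - Qcoef p c2 z)"
    "dx (Qcoef p c2) z = 2 * \<i> * (complex_of_real (c1 - (cmod (p z))\<^sup>2 / 2) * p z - Wcoef p c1 c2 z)"
    "dx (Wcoef p c1 c2) z = 2 * \<i> * complex_of_real (hcoef c0 c2 (p z) (Qcoef p c2 z)) * p z"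
    "dt p z + 2 * complex_of_real c2 * dx p z = 4 * \<i> * (c1 * p z - Wcoef p c1 c2 z)"
    "dt (Qcoef p c2) z + 2 * complex_of_real c2 * dx (Qcoef p c2) z
      = 4 * \<i> * (complex_of_real (hcoef c0 c2 (p z) (Qcoef p c2 z)) * p z + c1 * Qcoef p c2 z - c2 * Wcoef p c1 c2 z)"
    "dt (Wcoef p c1 c2) z + 2 * complex_of_real c2 * dx (Wcoef p c1 c2) z
      = 2 * \<i> * complex_of_real ((cmod (p z))\<^sup>2) * Wcoef p c1 c2 z
        + 4 * \<i> * complex_of_real (hcoef c0 c2 (p z) (Qcoef p c2 z)) * Qcoef p c2 z"
proof -
  show Px: "dx p z = 2 * \<i> * (c2 * p z - Qcoef p c2 z)"
  proof -
    have "X = 2 * \<i> * (c2 * Y - (\<i> / 2 * X + c2 * Y))" for X Y :: complex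
      by (simp add: complex_eq_iff algebra_simps)
    then show ?thesis unfolding Qcoef_def .
  qed
  have n: "complex_of_real ((cmod (p z))\<^sup>2) = 2 * complex_of_real c1 - 2 * complex_of_real (c1 - (cmod (p z))\<^sup>2 / 2)"
    by simp
  note * = lax_flow_coefficients[OF
      two_phase_Psi12(1)[OF tp, unfolded dx_dt_Psi12[OF sm] Psi_coefficients[OF sm]]
      two_phase_Psi12(2)[OF tp, unfolded dx_dt_Psi12[OF sm] Psi_coefficients[OF sm] sqabs_def] Px n]
  show "dx (Qcoef p c2) z = 2 * \<i> * (complex_of_real (c1 - (cmod (p z))\<^sup>2 / 2) * p z - Wcoef p c1 c2 z)"
    by (rule *(1))
  show "dx (Wcoef p c1 c2) z = 2 * \<i> * complex_of_real (hcoef c0 c2 (p z) (Qcoef p c2 z)) * p z"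
    by (rule *(2))
  show "dt p z + 2 * complex_of_real c2 * dx p z = 4 * \<i> * (c1 * p z - Wcoef p c1 c2 z)"
    by (rule *(3))
  show "dt (Qcoef p c2) z + 2 * complex_of_real c2 * dx (Qcoef p c2) z
      = 4 * \<i> * (complex_of_real (hcoef c0 c2 (p z) (Qcoef p c2 z)) * p z + c1 * Qcoef p c2 z - c2 * Wcoef p c1 c2 z)"
    by (rule *(4))
  show "dt (Wcoef p c1 c2) z + 2 * complex_of_real c2 * dx (Wcoef p c1 c2) z
      = 2 * \<i> * complex_of_real ((cmod (p z))\<^sup>2) * Wcoef p c1 c2 z
        + 4 * \<i> * complex_of_real (hcoef c0 c2 (p z) (Qcoef p c2 z)) * Qcoef p c2 z"
    by (rule *(5))
qed

section \<open>Critical points of the squared amplitude\<close>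

text \<open>\<open>field_P\<close>, \<open>field_Q\<close> and \<open>field_W\<close> form the
  vector field on triples \<open>(P, Q, W)\<close> for the direction with coordinates
  \<open>(\<alpha> + 2 * c2 * \<beta>, \<beta>)\<close>; keeping both parameters covers every
  direction of the Hessian.\<close>

definition field_P :: "real \<Rightarrow> real \<Rightarrow> real \<Rightarrow> real \<Rightarrow> complex \<Rightarrow> complex \<Rightarrow> complex \<Rightarrow> complex" where
  "field_P c1 c2 \<alpha> \<beta> P Q W = \<alpha> * (2 * \<i> * (c2 * P - Q)) + \<beta> * (4 * \<i> * (c1 * P - W))"

definition field_Q :: "real \<Rightarrow> real \<Rightarrow> real \<Rightarrow> real \<Rightarrow> real \<Rightarrow> complex \<Rightarrow> complex \<Rightarrow> complex \<Rightarrow> complex" where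
  "field_Q c0 c1 c2 \<alpha> \<beta> P Q W = \<alpha> * (2 * \<i> * (complex_of_real (c1 - (cmod P)\<^sup>2 / 2) * P - W))
     + \<beta> * (4 * \<i> * (complex_of_real (hcoef c0 c2 P Q) * P + c1 * Q - c2 * W))"

definition field_W :: "real \<Rightarrow> real \<Rightarrow> real \<Rightarrow> real \<Rightarrow> complex \<Rightarrow> complex \<Rightarrow> complex \<Rightarrow> complex" where
  "field_W c0 c2 \<alpha> \<beta> P Q W = \<alpha> * (2 * \<i> * complex_of_real (hcoef c0 c2 P Q) * P)
     + \<beta> * (2 * \<i> * complex_of_real ((cmod P)\<^sup>2) * W + 4 * \<i> * complex_of_real (hcoef c0 c2 P Q) * Q)"

text \<open>First and second derivative of \<open>|p|\<^sup>2\<close> along \<open>\<alpha> \<partial>\<^sub>x + \<beta> (\<partial>\<^sub>t + 2 c\<^sub>2 \<partial>\<^sub>x)\<close>;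
  the combination \<open>\<partial>\<^sub>t + 2 c\<^sub>2 \<partial>\<^sub>x\<close> is the one in which \<open>c\<^sub>2\<close> drops out of the first derivative.\<close>

definition nu_slope :: "real \<Rightarrow> real \<Rightarrow> complex \<Rightarrow> complex \<Rightarrow> complex \<Rightarrow> real" where
  "nu_slope \<alpha> \<beta> P Q W = 4 * \<alpha> * Im (cnj P * Q) + 8 * \<beta> * Im (cnj P * W)"

definition nu_bend :: "real \<Rightarrow> real \<Rightarrow> real \<Rightarrow> real \<Rightarrow> real \<Rightarrow> complex \<Rightarrow> complex \<Rightarrow> complex \<Rightarrow> real" where
  "nu_bend c0 c1 c2 \<alpha> \<beta> P Q W =
     4 * \<alpha> * Im (cnj (field_P c1 c2 \<alpha> \<beta> P Q W) * Q + cnj P * field_Q c0 c1 c2 \<alpha> \<beta> P Q W)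
     + 8 * \<beta> * Im (cnj (field_P c1 c2 \<alpha> \<beta> P Q W) * W + cnj P * field_W c0 c2 \<alpha> \<beta> P Q W)"

lemma flow_along_line:
  fixes p :: "real \<times> real \<Rightarrow> complex" and \<alpha> \<beta> c2 :: real
  assumes sm: "smooth2 p" and tp: "two_phase p c0 c1 c2"
  defines "d \<equiv> (\<alpha> + 2 * c2 * \<beta>, \<beta>)"
  shows "((\<lambda>s. p (z + s *\<^sub>R d)) has_vector_derivative
      field_P c1 c2 \<alpha> \<beta> (p (z + s *\<^sub>R d)) (Qcoef p c2 (z + s *\<^sub>R d)) (Wcoef p c1 c2 (z + s *\<^sub>R d))) (at s)"
    and "((\<lambda>s. Qcoef p c2 (z + s *\<^sub>R d)) has_vector_derivative
      field_Q c0 c1 c2 \<alpha> \<beta> (p (z + s *\<^sub>R d)) (Qcoef p c2 (z + s *\<^sub>R d)) (Wcoef p c1 c2 (z + s *\<^sub>R d))) (at s)"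
    and "((\<lambda>s. Wcoef p c1 c2 (z + s *\<^sub>R d)) has_vector_derivative
      field_W c0 c2 \<alpha> \<beta> (p (z + s *\<^sub>R d)) (Qcoef p c2 (z + s *\<^sub>R d)) (Wcoef p c1 c2 (z + s *\<^sub>R d))) (at s)"
proof -
  have comb: "fst d *\<^sub>R X + snd d *\<^sub>R T = \<alpha> * X + \<beta> * (T + 2 * complex_of_real c2 * X)" for X T :: complex
    by (simp add: d_def scaleR_conv_of_real algebra_simps)
  note diff = smooth2_differentiable(1)[OF sm] Qcoef_Wcoef_differentiable[OF sm]
  show "((\<lambda>s. p (z + s *\<^sub>R d)) has_vector_derivative
      field_P c1 c2 \<alpha> \<beta> (p (z + s *\<^sub>R d)) (Qcoef p c2 (z + s *\<^sub>R d)) (Wcoef p c1 c2 (z + s *\<^sub>R d))) (at s)"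
    using has_vector_derivative_along_line[of p z s d, OF diff(1)]
    unfolding comb flow_equations(4)[OF sm tp] unfolding flow_equations(1)[OF sm tp] field_P_def .
  show "((\<lambda>s. Qcoef p c2 (z + s *\<^sub>R d)) has_vector_derivative
      field_Q c0 c1 c2 \<alpha> \<beta> (p (z + s *\<^sub>R d)) (Qcoef p c2 (z + s *\<^sub>R d)) (Wcoef p c1 c2 (z + s *\<^sub>R d))) (at s)"
    using has_vector_derivative_along_line[of "Qcoef p c2" z s d, OF diff(2)]
    unfolding comb flow_equations(5)[OF sm tp] unfolding flow_equations(2)[OF sm tp] field_Q_def .
  show "((\<lambda>s. Wcoef p c1 c2 (z + s *\<^sub>R d)) has_vector_derivative
      field_W c0 c2 \<alpha> \<beta> (p (z + s *\<^sub>R d)) (Qcoef p c2 (z + s *\<^sub>R d)) (Wcoef p c1 c2 (z + s *\<^sub>R d))) (at s)"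
    using has_vector_derivative_along_line[of "Wcoef p c1 c2" z s d, OF diff(3)]
    unfolding comb flow_equations(6)[OF sm tp] unfolding flow_equations(3)[OF sm tp] field_W_def .
qed

lemma has_real_derivative_cmod_power2:
  assumes "(f has_vector_derivative f') (at s)"
  shows "((\<lambda>s. (cmod (f s))\<^sup>2) has_real_derivative 2 * Re (cnj (f s) * f')) (at s)"
proof -
  have Re: "((\<lambda>s. Re (f s)) has_real_derivative Re f') (at s)"
    and Im: "((\<lambda>s. Im (f s)) has_real_derivative Im f') (at s)"
    using bounded_linear.has_vector_derivative[OF bounded_linear_Re assms]
      bounded_linear.has_vector_derivative[OF bounded_linear_Im assms]
    by (simp_all add: has_real_derivative_iff_has_vector_derivative)
  from DERIV_add[OF DERIV_power[OF Re, of 2] DERIV_power[OF Im, of 2]] show ?thesis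
    unfolding cmod_power2 by (simp add: algebra_simps)
qed

lemma has_real_derivative_Im_cnj_mult:
  assumes "(f has_vector_derivative f') (at s)" "(g has_vector_derivative g') (at s)"
  shows "((\<lambda>s. Im (cnj (f s) * g s)) has_real_derivative Im (cnj f' * g s + cnj (f s) * g')) (at s)"
proof -
  have "((\<lambda>s. cnj (f s)) has_vector_derivative cnj f') (at s)"
    by (rule bounded_linear.has_vector_derivative[OF bounded_linear_cnj assms(1)])
  from has_vector_derivative_mult[OF this assms(2)]
  have "((\<lambda>s. cnj (f s) * g s) has_vector_derivative (cnj f' * g s + cnj (f s) * g')) (at s)"
    by (simp add: add.commute)
  from bounded_linear.has_vector_derivative[OF bounded_linear_Im this]
  show ?thesis by (simp only: has_real_derivative_iff_has_vector_derivative)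
qed

lemma nu_derivatives:
  fixes p :: "real \<times> real \<Rightarrow> complex" and \<alpha> \<beta> c2 :: real
  assumes sm: "smooth2 p" and tp: "two_phase p c0 c1 c2"
  defines "d \<equiv> (\<alpha> + 2 * c2 * \<beta>, \<beta>)"
  shows "((\<lambda>s. (cmod (p (z + s *\<^sub>R d)))\<^sup>2) has_real_derivative
      nu_slope \<alpha> \<beta> (p (z + s *\<^sub>R d)) (Qcoef p c2 (z + s *\<^sub>R d)) (Wcoef p c1 c2 (z + s *\<^sub>R d))) (at s)"
    and "((\<lambda>s. nu_slope \<alpha> \<beta> (p (z + s *\<^sub>R d)) (Qcoef p c2 (z + s *\<^sub>R d)) (Wcoef p c1 c2 (z + s *\<^sub>R d)))
      has_real_derivative
      nu_bend c0 c1 c2 \<alpha> \<beta> (p (z + s *\<^sub>R d)) (Qcoef p c2 (z + s *\<^sub>R d)) (Wcoef p c1 c2 (z + s *\<^sub>R d))) (at s)"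
proof -
  note fl = flow_along_line[OF sm tp, of z \<alpha> \<beta> s, folded d_def]
  have *: "2 * Re (cnj P * field_P c1 c2 \<alpha> \<beta> P Q W) = nu_slope \<alpha> \<beta> P Q W" for P Q W
    by (simp add: field_P_def nu_slope_def algebra_simps)
  show "((\<lambda>s. (cmod (p (z + s *\<^sub>R d)))\<^sup>2) has_real_derivative
      nu_slope \<alpha> \<beta> (p (z + s *\<^sub>R d)) (Qcoef p c2 (z + s *\<^sub>R d)) (Wcoef p c1 c2 (z + s *\<^sub>R d))) (at s)"
    using has_real_derivative_cmod_power2[OF fl(1)] unfolding * .
  show "((\<lambda>s. nu_slope \<alpha> \<beta> (p (z + s *\<^sub>R d)) (Qcoef p c2 (z + s *\<^sub>R d)) (Wcoef p c1 c2 (z + s *\<^sub>R d)))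
      has_real_derivative
      nu_bend c0 c1 c2 \<alpha> \<beta> (p (z + s *\<^sub>R d)) (Qcoef p c2 (z + s *\<^sub>R d)) (Wcoef p c1 c2 (z + s *\<^sub>R d))) (at s)"
    unfolding nu_slope_def nu_bend_def
    by (intro DERIV_add DERIV_cmult has_real_derivative_Im_cnj_mult fl)
qed

text \<open>Vanishing slopes make \<open>Q\<close> and \<open>W\<close> real multiples
  \<open>m1\<close>, \<open>m0\<close> of \<open>P\<close>, so \<open>critical_discriminant\<close>
  applies with \<open>\<kappa> = cmod P\<close>. In the variables \<open>\<alpha>\<close> and
  \<open>2 * \<beta>\<close> the Hessian form has, up to a positive factor, the matrix with rows
  \<open>(a, b)\<close> and \<open>(b, b*m1 - a*m0)\<close>; its determinant is minus the
  resultant.\<close>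

lemma critical_point:
  fixes P Q W v1 v2 v3 :: complex and c0 c1 c2 :: real
  assumes R: "\<And>l::complex. (l^3 + c2 * l\<^sup>2 + complex_of_real (c1 - (cmod P)\<^sup>2 / 2) * l + hcoef c0 c2 P Q)\<^sup>2
      + (P * l\<^sup>2 + Q * l + W) * (cnj P * l\<^sup>2 + cnj Q * l + cnj W)
      = (l-v1)*(l-cnj v1)*(l-v2)*(l-cnj v2)*(l-v3)*(l-cnj v3)"
    and d: "v1 \<noteq> v2" "v1 \<noteq> cnj v2" "v1 \<noteq> v3" "v1 \<noteq> cnj v3" "v2 \<noteq> v3" "v2 \<noteq> cnj v3"
    and slope: "\<And>\<alpha> \<beta>. nu_slope \<alpha> \<beta> P Q W = 0" and P: "P \<noteq> 0"
  obtains e1 e2 e3 D a b m1 m0 where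
    "e1 \<in> {Im v1, - Im v1}" "e2 \<in> {Im v2, - Im v2}" "e3 \<in> {Im v3, - Im v3}"
    "cmod P = e1 + e2 + e3" "D > 0" "(cmod P)^3 * (a\<^sup>2*m0 - a*b*m1 + b\<^sup>2) = - (e1*e2*e3*D)"
    "\<And>\<alpha> \<beta>. nu_bend c0 c1 c2 \<alpha> \<beta> P Q W = 8 * (cmod P)\<^sup>2 * (a * \<alpha>\<^sup>2 + 4*b*\<alpha>*\<beta> + 4*(b*m1 - a*m0)*\<beta>\<^sup>2)"
proof -
  have real_multiple: "X = complex_of_real (Re (cnj P * X) / (cmod P)\<^sup>2) * P" if "Im (cnj P * X) = 0" for X
  proof -
    have "complex_of_real (Re (cnj P * X)) = cnj P * X" using that by (simp add: complex_eq_iff)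
    then show ?thesis using P by (simp add: complex_norm_square del: of_real_power)
  qed
  obtain m1 where m1: "Q = complex_of_real m1 * P"
    by (rule that[OF real_multiple]) (use slope[of 1 0] in \<open>simp add: nu_slope_def\<close>)
  obtain m0 where m0: "W = complex_of_real m0 * P"
    by (rule that[OF real_multiple]) (use slope[of 0 1] in \<open>simp add: nu_slope_def\<close>)
  define h where "h = hcoef c0 c2 P Q"
  define f1 where "f1 = c1 - (cmod P)\<^sup>2 / 2"
  define a where "a = f1 - m0 - c2*m1 + m1\<^sup>2"
  define b where "b = h - c2*m0 + m1*m0"
  have "(l^3 + c2 * l\<^sup>2 + f1 * l + h)\<^sup>2 + (cmod P)\<^sup>2 * (l\<^sup>2 + m1 * l + m0)\<^sup>2
      = (l-v1)*(l-cnj v1)*(l-v2)*(l-cnj v2)*(l-v3)*(l-cnj v3)" for l :: complex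
  proof -
    have "(P * l\<^sup>2 + Q * l + W) * (cnj P * l\<^sup>2 + cnj Q * l + cnj W) = (P * cnj P) * (l\<^sup>2 + m1 * l + m0)\<^sup>2"
      unfolding m1 m0 by (simp add: algebra_simps power2_eq_square)
    then show ?thesis using R[of l] unfolding h_def[symmetric] f1_def[symmetric] by (simp add: complex_norm_square del: of_real_power)
  qed
  from critical_discriminant[OF this d a_def b_def]
  obtain e1 e2 e3 D where e: "e1 \<in> {Im v1, - Im v1}" "e2 \<in> {Im v2, - Im v2}" "e3 \<in> {Im v3, - Im v3}"
    "cmod P = e1 + e2 + e3" "D > 0" "(cmod P)^3 * (a\<^sup>2*m0 - a*b*m1 + b\<^sup>2) = - (e1*e2*e3*D)" by blast
  have rotate: "Im (cnj (2 * \<i> * P * complex_of_real A) * (complex_of_real m * P) + cnj P * (2 * \<i> * P * complex_of_real B))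
      = 2 * (cmod P)\<^sup>2 * (B - A * m)" for A B m
    unfolding cmod_power2 by (simp add: algebra_simps power2_eq_square)
  have "nu_bend c0 c1 c2 \<alpha> \<beta> P Q W = 8 * (cmod P)\<^sup>2 * (a * \<alpha>\<^sup>2 + 4*b*\<alpha>*\<beta> + 4*(b*m1 - a*m0)*\<beta>\<^sup>2)" for \<alpha> \<beta>
  proof -
    \<comment> \<open>At a critical point the vector field is \<open>2 * i * P\<close> times the
      real triple \<open>(A, B, C)\<close>, which reduces both summands of the bend to
      \<open>rotate\<close>.\<close>
    define A where "A = \<alpha> * (c2 - m1) + 2 * \<beta> * (c1 - m0)"
    define B where "B = \<alpha> * (f1 - m0) + 2 * \<beta> * (h + c1 * m1 - c2 * m0)"
    define C where "C = \<alpha> * h + \<beta> * ((cmod P)\<^sup>2 * m0 + 2 * h * m1)"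
    have 1: "field_P c1 c2 \<alpha> \<beta> P Q W = 2 * \<i> * P * complex_of_real A"
      unfolding field_P_def A_def m1 m0 by (simp add: algebra_simps)
    have 2: "field_Q c0 c1 c2 \<alpha> \<beta> P Q W = 2 * \<i> * P * complex_of_real B"
      unfolding field_Q_def B_def h_def[symmetric] f1_def[symmetric] unfolding m1 m0 by (simp add: algebra_simps)
    have 3: "field_W c0 c2 \<alpha> \<beta> P Q W = 2 * \<i> * P * complex_of_real C"
      unfolding field_W_def C_def h_def[symmetric] unfolding m1 m0 by (simp add: algebra_simps)
    have Q: "Im (cnj (field_P c1 c2 \<alpha> \<beta> P Q W) * Q + cnj P * field_Q c0 c1 c2 \<alpha> \<beta> P Q W)
        = 2 * (cmod P)\<^sup>2 * (B - A * m1)"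
      unfolding 1 2 using rotate[of A m1 B] unfolding m1[symmetric] .
    have W: "Im (cnj (field_P c1 c2 \<alpha> \<beta> P Q W) * W + cnj P * field_W c0 c2 \<alpha> \<beta> P Q W)
        = 2 * (cmod P)\<^sup>2 * (C - A * m0)"
      unfolding 1 3 using rotate[of A m0 C] unfolding m0[symmetric] .
    have n: "(cmod P)\<^sup>2 = 2 * (c1 - f1)" by (simp add: f1_def)
    show ?thesis unfolding nu_bend_def Q W unfolding A_def B_def C_def a_def b_def n by algebra
  qed
  with e that show ?thesis by blast
qed

lemma semidefinite_discriminant:
  fixes \<sigma> k a b c :: real
  assumes \<sigma>: "\<sigma> = 1 \<or> \<sigma> = - 1" and k: "k > 0"
    and semi: "\<And>\<alpha> \<beta>. \<sigma> * (k * (a * \<alpha>\<^sup>2 + 4*b*\<alpha>*\<beta> + 4*c*\<beta>\<^sup>2)) \<le> 0"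
  shows "b\<^sup>2 \<le> a * c"
proof -
  have semi': "\<sigma> * (a * \<alpha>\<^sup>2 + 4*b*\<alpha>*\<beta> + 4*c*\<beta>\<^sup>2) \<le> 0" for \<alpha> \<beta>
    using semi[of \<alpha> \<beta>] k by (metis mult.left_commute mult_le_0_iff not_less)
  show ?thesis
  proof (cases "a = 0")
    case True
    have "b = 0"
    proof (rule ccontr)
      assume "b \<noteq> 0"
      \<comment> \<open>At this point the form equals \<open>4 * \<sigma>\<close>, and
        \<open>\<sigma>\<close> times that is 4.\<close>
      then show False using semi'[of "(\<sigma> - c) / b" 1] \<sigma> True by auto
    qed
    with True show ?thesis by simp
  next
    case False
    have "\<sigma> * a \<le> 0" using semi'[of 1 0] by simp
    then have neg: "\<sigma> * a < 0" using False \<sigma> by auto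
    \<comment> \<open>The test vector \<open>(-2*b, a)\<close> gives the form the value
      \<open>4 * a * (a*c - b^2)\<close>.\<close>
    have "\<sigma> * a * (4 * (a * c - b\<^sup>2)) \<le> 0"
      using semi'[of "- 2 * b" a] by (simp add: algebra_simps power2_eq_square)
    with neg show ?thesis by (simp add: mult_le_0_iff)
  qed
qed

section \<open>The amplitude range\<close>

text \<open>\<open>\<sigma>\<close> is 1 at a maximum and -1 at a minimum. Either semidefiniteness
  makes the resultant nonpositive, hence the product of the signed imaginary parts positive. The
  resultant itself is nonzero, so the Hessian cannot vanish.\<close>

lemma extremal_value:
  fixes P Q W v1 v2 v3 :: complex and c0 c1 c2 \<sigma> :: real
  assumes R: "\<And>l::complex. (l^3 + c2 * l\<^sup>2 + complex_of_real (c1 - (cmod P)\<^sup>2 / 2) * l + hcoef c0 c2 P Q)\<^sup>2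
      + (P * l\<^sup>2 + Q * l + W) * (cnj P * l\<^sup>2 + cnj Q * l + cnj W)
      = (l-v1)*(l-cnj v1)*(l-v2)*(l-cnj v2)*(l-v3)*(l-cnj v3)"
    and d: "v1 \<noteq> v2" "v1 \<noteq> cnj v2" "v1 \<noteq> v3" "v1 \<noteq> cnj v3" "v2 \<noteq> v3" "v2 \<noteq> cnj v3"
    and slope: "\<And>\<alpha> \<beta>. nu_slope \<alpha> \<beta> P Q W = 0" and P: "P \<noteq> 0"
    and ord: "0 < Im v1" "Im v1 \<le> Im v2" "Im v2 \<le> Im v3"
  shows "\<sigma> = 1 \<or> \<sigma> = - 1 \<Longrightarrow> (\<And>\<alpha> \<beta>. \<sigma> * nu_bend c0 c1 c2 \<alpha> \<beta> P Q W \<le> 0) \<Longrightarrow>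
      cmod P = Im v1 + Im v2 + Im v3 \<or> cmod P = Im v3 - Im v1 - Im v2"
    and "\<exists>\<alpha> \<beta>. nu_bend c0 c1 c2 \<alpha> \<beta> P Q W \<noteq> 0"
proof -
  obtain e1 e2 e3 D a b m1 m0 where e: "e1 \<in> {Im v1, - Im v1}" "e2 \<in> {Im v2, - Im v2}" "e3 \<in> {Im v3, - Im v3}"
    and \<kappa>: "cmod P = e1 + e2 + e3" and D: "D > 0"
    and disc: "(cmod P)^3 * (a\<^sup>2*m0 - a*b*m1 + b\<^sup>2) = - (e1*e2*e3*D)"
    and bend: "\<And>\<alpha> \<beta>. nu_bend c0 c1 c2 \<alpha> \<beta> P Q W = 8 * (cmod P)\<^sup>2 * (a * \<alpha>\<^sup>2 + 4*b*\<alpha>*\<beta> + 4*(b*m1 - a*m0)*\<beta>\<^sup>2)"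
    by (rule critical_point[OF R d slope P]) blast
  have pos: "cmod P > 0" using P by simp
  have e0: "e1*e2*e3 \<noteq> 0" using e ord by auto
  show "cmod P = Im v1 + Im v2 + Im v3 \<or> cmod P = Im v3 - Im v1 - Im v2"
    if \<sigma>: "\<sigma> = 1 \<or> \<sigma> = - 1" and semi: "\<And>\<alpha> \<beta>. \<sigma> * nu_bend c0 c1 c2 \<alpha> \<beta> P Q W \<le> 0"
  proof -
    have "b\<^sup>2 \<le> a * (b*m1 - a*m0)"
      by (rule semidefinite_discriminant[OF \<sigma>, of "8 * (cmod P)\<^sup>2"]) (use P semi in \<open>simp_all add: bend\<close>)
    then have "a\<^sup>2*m0 - a*b*m1 + b\<^sup>2 \<le> 0" by (simp add: algebra_simps power2_eq_square)
    then have "(cmod P)^3 * (a\<^sup>2*m0 - a*b*m1 + b\<^sup>2) \<le> 0" using pos by (simp add: mult_le_0_iff)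
    then have "e1*e2*e3 \<ge> 0" using D unfolding disc by (simp add: zero_le_mult_iff)
    then have "e1*e2*e3 > 0" by (rule order.not_eq_order_implies_strict[OF e0[symmetric]])
    then have "(e1 > 0 \<and> e2 > 0 \<and> e3 > 0) \<or> (e1 > 0 \<and> e2 < 0 \<and> e3 < 0)
        \<or> (e1 < 0 \<and> e2 > 0 \<and> e3 < 0) \<or> (e1 < 0 \<and> e2 < 0 \<and> e3 > 0)"
      by (auto simp: zero_less_mult_iff mult_less_0_iff)
    \<comment> \<open>With exactly two negative terms, the sum is positive only if the largest term
      keeps its sign.\<close>
    then show ?thesis using e ord \<kappa> pos by auto
  qed
  show "\<exists>\<alpha> \<beta>. nu_bend c0 c1 c2 \<alpha> \<beta> P Q W \<noteq> 0"
  proof (rule ccontr)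
    assume "\<not> ?thesis"
    then have zero: "a * \<alpha>\<^sup>2 + 4*b*\<alpha>*\<beta> + 4*(b*m1 - a*m0)*\<beta>\<^sup>2 = 0" for \<alpha> \<beta>
      using bend[of \<alpha> \<beta>] P by simp
    have "a = 0" using zero[of 1 0] by simp
    moreover have "b = 0" using zero[of 1 1] zero[of 1 "-1"] by simp
    ultimately show False using disc e0 D by simp
  qed
qed

section \<open>The compact closure of the orbit\<close>

text \<open>At real \<open>x\<close> the spectral identity bounds the quadratic
  \<open>P x^2 + Q x + W\<close>, and its values at 0, 1 and -1 determine the three
  coefficients.\<close>

lemma bounded_spectral_data:
  fixes p :: "real \<times> real \<Rightarrow> complex"
  assumes sm: "smooth2 p" and R: "\<And>l z. spectral_R p c0 c1 c2 l z = R l"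
  shows "bounded (range (\<lambda>z. (p z, Qcoef p c2 z, Wcoef p c1 c2 z)))"
proof -
  have bd: "(cmod (p z * complex_of_real x ^ 2 + Qcoef p c2 z * x + Wcoef p c1 c2 z))\<^sup>2 \<le> cmod (R x)" for z and x :: real
  proof -
    define f where "f = x^3 + c2 * x\<^sup>2 + (c1 - (cmod (p z))\<^sup>2 / 2) * x + hcoef c0 c2 (p z) (Qcoef p c2 z)"
    define m where "m = p z * complex_of_real x ^ 2 + Qcoef p c2 z * x + Wcoef p c1 c2 z"
    have "R x = (complex_of_real f)\<^sup>2 + m * cnj m"
      unfolding R[symmetric, of _ z] spectral_R_coefficients[OF sm] f_def m_def by simp
    also have "\<dots> = complex_of_real (f\<^sup>2 + (cmod m)\<^sup>2)" by (simp add: complex_norm_square[symmetric])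
    finally have "cmod (R x) = \<bar>f\<^sup>2 + (cmod m)\<^sup>2\<bar>" by (metis norm_of_real)
    then show ?thesis unfolding m_def by simp
  qed
  \<comment> \<open>A linear bound in place of a square root; the three added units are the 3 in
    \<open>K\<close>.\<close>
  have sq: "t \<le> K + 1" if "t\<^sup>2 \<le> K" for t K :: real
  proof -
    have "2 * t \<le> t\<^sup>2 + 1" using sum_squares_bound[of t 1] by (simp add: power2_eq_square)
    moreover have "0 \<le> t\<^sup>2" by simp
    ultimately show ?thesis using that by linarith
  qed
  define K where "K = cmod (R 0) + cmod (R 1) + cmod (R (- 1)) + 3"
  have comb: "cmod A \<le> K \<Longrightarrow> cmod B \<le> K \<Longrightarrow> cmod C \<le> K \<Longrightarrow> cmod (A + B - 2 * C) \<le> 4 * K"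
    "cmod A \<le> K \<Longrightarrow> cmod B \<le> K \<Longrightarrow> cmod (A - B) \<le> 2 * K" for A B C
    using norm_triangle_ineq4[of "A + B" "2 * C"] norm_triangle_ineq[of A B] norm_triangle_ineq4[of A B]
    by (simp_all add: norm_mult)
  have "norm (p z, Qcoef p c2 z, Wcoef p c1 c2 z) \<le> 5 * K" for z
  proof -
    note nonneg = norm_ge_zero[of "R 0"] norm_ge_zero[of "R 1"] norm_ge_zero[of "R (- 1)"]
    have "cmod (Wcoef p c1 c2 z) \<le> cmod (R 0) + 1"
      "cmod (p z + Qcoef p c2 z + Wcoef p c1 c2 z) \<le> cmod (R 1) + 1"
      "cmod (p z - Qcoef p c2 z + Wcoef p c1 c2 z) \<le> cmod (R (- 1)) + 1"
      using sq[OF bd[of z 0]] sq[OF bd[of z 1]] sq[OF bd[of z "- 1"]] by simp_all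
    with nonneg have 0: "cmod (Wcoef p c1 c2 z) \<le> K"
      and 1: "cmod (p z + Qcoef p c2 z + Wcoef p c1 c2 z) \<le> K"
      and 2: "cmod (p z - Qcoef p c2 z + Wcoef p c1 c2 z) \<le> K"
      unfolding K_def by linarith+
    have "2 * cmod (p z) \<le> 4 * K"
      using comb(1)[OF 1 2 0] by (simp add: norm_mult)
    moreover have "2 * cmod (Qcoef p c2 z) \<le> 2 * K"
      using comb(2)[OF 1 2] by (simp add: norm_mult)
    moreover have "norm (p z, Qcoef p c2 z, Wcoef p c1 c2 z) \<le> cmod (p z) + (cmod (Qcoef p c2 z) + cmod (Wcoef p c1 c2 z))"
      by (intro order_trans[OF norm_Pair_le] add_left_mono norm_Pair_le)
    ultimately show ?thesis using 0 norm_ge_zero[of "p z"] by linarith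
  qed
  then show ?thesis unfolding bounded_iff by blast
qed

text \<open>The factor \<open>\<sigma>\<close> lets one application of \<open>max_principle\<close>
  serve maxima and minima of the squared amplitude, also at limit points that the orbit does not
  reach.\<close>

lemma extremum_on_closure:
  fixes p :: "real \<times> real \<Rightarrow> complex" and c1 c2 \<sigma> :: real
  defines "u \<equiv> \<lambda>z. (p z, Qcoef p c2 z, Wcoef p c1 c2 z)"
  assumes sm: "smooth2 p" and tp: "two_phase p c0 c1 c2" and bdd: "bounded (range u)"
    and y: "(P, Q, W) \<in> closure (range u)"
    and ext: "\<And>z. \<sigma> * (cmod (p z))\<^sup>2 \<le> \<sigma> * (cmod P)\<^sup>2" and \<sigma>: "\<sigma> \<noteq> 0"
  shows "nu_slope \<alpha> \<beta> P Q W = 0" "\<sigma> * nu_bend c0 c1 c2 \<alpha> \<beta> P Q W \<le> 0"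
proof -
  define d where "d = (\<alpha> + 2 * c2 * \<beta>, \<beta>)"
  note fl = flow_along_line[OF sm tp, where \<alpha> = \<alpha> and \<beta> = \<beta>, folded d_def]
  note nd = nu_derivatives[OF sm tp, where \<alpha> = \<alpha> and \<beta> = \<beta>, folded d_def]
  let ?at = "\<lambda>F y. F (fst y) (fst (snd y)) (snd (snd y))"
  let ?N = "\<lambda>y::complex \<times> complex \<times> complex. \<sigma> * (cmod (fst y))\<^sup>2"
  let ?N1 = "\<lambda>y::complex \<times> complex \<times> complex. \<sigma> * ?at (nu_slope \<alpha> \<beta>) y"
  let ?N2 = "\<lambda>y::complex \<times> complex \<times> complex. \<sigma> * ?at (nu_bend c0 c1 c2 \<alpha> \<beta>) y"
  let ?W = "\<lambda>y::complex \<times> complex \<times> complex. (?at (field_P c1 c2 \<alpha> \<beta>) y, ?at (field_Q c0 c1 c2 \<alpha> \<beta>) y, ?at (field_W c0 c2 \<alpha> \<beta>) y)"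
  have "continuous_on UNIV ?N" "continuous_on UNIV ?N1" "continuous_on UNIV ?N2" "continuous_on UNIV ?W"
    unfolding nu_slope_def nu_bend_def field_P_def field_Q_def field_W_def hcoef_def
    by (auto intro!: continuous_intros)
  moreover have "((\<lambda>s. u (z + s *\<^sub>R d)) has_vector_derivative ?W (u (z + s *\<^sub>R d))) (at s)" for z s
    unfolding u_def by (simp add: has_vector_derivative_Pair fl)
  moreover have "((\<lambda>s. ?N (u (z + s *\<^sub>R d))) has_real_derivative ?N1 (u (z + s *\<^sub>R d))) (at s)" for z s
    unfolding u_def by (simp add: DERIV_cmult nd)
  moreover have "((\<lambda>s. ?N1 (u (z + s *\<^sub>R d))) has_real_derivative ?N2 (u (z + s *\<^sub>R d))) (at s)" for z s
    unfolding u_def by (simp add: DERIV_cmult nd)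
  moreover have "?N (u z) \<le> ?N (P, Q, W)" for z using ext by (simp add: u_def)
  ultimately have "?N1 (P, Q, W) = 0" "?N2 (P, Q, W) \<le> 0"
    using max_principle[OF bdd, where N = ?N and ?N1.0 = ?N1 and ?N2.0 = ?N2 and W = ?W and d = d and y = "(P, Q, W)"] y
    by blast+
  then show "nu_slope \<alpha> \<beta> P Q W = 0" "\<sigma> * nu_bend c0 c1 c2 \<alpha> \<beta> P Q W \<le> 0" using \<sigma> by simp_all
qed

text \<open>For fixed \<open>l\<close> the identity is a closed condition on the triple, so it
  survives passage to the closure.\<close>

lemma spectral_identity_closure:
  fixes p :: "real \<times> real \<Rightarrow> complex" and l :: complex
  assumes sm: "smooth2 p" and R: "\<And>z. spectral_R p c0 c1 c2 l z = r"
    and y: "(P, Q, W) \<in> closure (range (\<lambda>z. (p z, Qcoef p c2 z, Wcoef p c1 c2 z)))"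
  shows "(l^3 + c2 * l\<^sup>2 + complex_of_real (c1 - (cmod P)\<^sup>2 / 2) * l + hcoef c0 c2 P Q)\<^sup>2
      + (P * l\<^sup>2 + Q * l + W) * (cnj P * l\<^sup>2 + cnj Q * l + cnj W) = r"
proof -
  let ?F = "\<lambda>y. (l^3 + c2 * l\<^sup>2 + complex_of_real (c1 - (cmod (fst y))\<^sup>2 / 2) * l + hcoef c0 c2 (fst y) (fst (snd y)))\<^sup>2
      + (fst y * l\<^sup>2 + fst (snd y) * l + snd (snd y)) * (cnj (fst y) * l\<^sup>2 + cnj (fst (snd y)) * l + cnj (snd (snd y)))"
  have "closed {y. ?F y = r}"
    unfolding hcoef_def by (intro closed_Collect_eq continuous_intros) auto
  moreover have "range (\<lambda>z. (p z, Qcoef p c2 z, Wcoef p c1 c2 z)) \<subseteq> {y. ?F y = r}"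
    using R unfolding spectral_R_coefficients[OF sm] by auto
  ultimately have "(P, Q, W) \<in> {y. ?F y = r}" using y closure_minimal by blast
  then show ?thesis by simp
qed

text \<open>For \<open>P = 0\<close> the second summand is the squared modulus of
  \<open>Q l + W\<close> at real \<open>l\<close>, whose discriminant is nonpositive since
  \<open>\<bar>Re (Q * cnj W)\<bar> \<le> cmod Q * cmod W\<close>. The ordering makes the other
  three factors of Heron's product positive.\<close>

lemma vanishing_amplitude:
  fixes Q W v1 v2 v3 :: complex and c0 c1 c2 :: real
  assumes R: "\<And>l::complex. (l^3 + c2 * l\<^sup>2 + complex_of_real f1 * l + complex_of_real h)\<^sup>2
      + (Q * l + W) * (cnj Q * l + cnj W)
      = (l-v1)*(l-cnj v1)*(l-v2)*(l-cnj v2)*(l-v3)*(l-cnj v3)"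
    and ord: "0 < Im v1" "Im v1 \<le> Im v2" "Im v2 \<le> Im v3"
  shows "Im v3 \<le> Im v1 + Im v2"
proof -
  have eq: "(l^3 + c2 * l\<^sup>2 + f1 * l + h)\<^sup>2 + ((cmod Q)\<^sup>2 * l^2 + 2 * Re (Q * cnj W) * l + (cmod W)\<^sup>2)
      = ((l - Re v1)^2 + (Im v1)^2) * ((l - Re v2)^2 + (Im v2)^2) * ((l - Re v3)^2 + (Im v3)^2)" for l :: real
  proof -
    have pair: "(l - v) * (l - cnj v) = complex_of_real ((l - Re v)^2 + (Im v)^2)" for v :: complex
      by (simp add: complex_eq_iff power2_eq_square algebra_simps)
    have quad: "(Q * l + W) * (cnj Q * l + cnj W)
        = complex_of_real ((cmod Q)\<^sup>2 * l^2 + 2 * Re (Q * cnj W) * l + (cmod W)\<^sup>2)"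
      unfolding cmod_power2 by (simp add: complex_eq_iff power2_eq_square algebra_simps)
    have "complex_of_real ((l^3 + c2 * l\<^sup>2 + f1 * l + h)\<^sup>2 + ((cmod Q)\<^sup>2 * l^2 + 2 * Re (Q * cnj W) * l + (cmod W)\<^sup>2))
      = ((l-v1)*(l-cnj v1))*((l-v2)*(l-cnj v2))*((l-v3)*(l-cnj v3))"
      using R[of "complex_of_real l"] unfolding quad by (simp add: mult.assoc)
    also have "\<dots> = complex_of_real (((l - Re v1)^2 + (Im v1)^2) * ((l - Re v2)^2 + (Im v2)^2) * ((l - Re v3)^2 + (Im v3)^2))"
      unfolding pair by simp
    finally show ?thesis by (simp only: of_real_eq_iff)
  qed
  have "\<bar>Re (Q * cnj W)\<bar> \<le> cmod Q * cmod W"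
    using abs_Re_le_cmod[of "Q * cnj W"] by (simp add: norm_mult)
  then have "(Re (Q * cnj W))\<^sup>2 \<le> (cmod Q * cmod W)\<^sup>2" by (simp add: abs_le_square_iff[symmetric])
  then have "(2 * Re (Q * cnj W))\<^sup>2 \<le> 4 * (cmod Q)\<^sup>2 * (cmod W)\<^sup>2"
    by (simp add: power_mult_distrib del: complex_mult_cnj times_complex.sel)
  from heron_nonneg[OF eq this] ord
  have "0 \<le> (Im v1 + Im v2 + Im v3) * (Im v1 + Im v2 - Im v3) * (Im v1 - Im v2 + Im v3) * (- Im v1 + Im v2 + Im v3)"
    by simp
  moreover have "Im v1 + Im v2 + Im v3 > 0" "Im v1 - Im v2 + Im v3 > 0" "- Im v1 + Im v2 + Im v3 > 0" using ord by linarith+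
  ultimately have "0 \<le> Im v1 + Im v2 - Im v3"
    by (auto simp: zero_le_mult_iff)
  then show ?thesis by simp
qed

theorem theorem7:
  fixes p :: "real \<times> real \<Rightarrow> complex"
    and c0 c1 c2 r1 r2 r3 s1 s2 s3 :: real
    and lam :: "nat \<Rightarrow> complex"
  assumes smooth: "smooth2 p"
    and nls: "focusing_NLS p"
    and nonzero: "\<exists>z. p z \<noteq> 0"
    and twophase: "two_phase p c0 c1 c2"
    and branch: "\<forall>l z. spectral_R p c0 c1 c2 l z = (\<Prod>j\<in>{1..6}. l - lam j)"
    and nonsing: "\<forall>j\<in>{1..6}. \<forall>k\<in>{1..6}. j \<noteq> k \<longrightarrow> lam j \<noteq> lam k"
    and l1: "lam 1 = Complex r1 s1" and l2: "lam 2 = cnj (lam 1)"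
    and l3: "lam 3 = Complex r2 s2" and l4: "lam 4 = cnj (lam 3)"
    and l5: "lam 5 = Complex r3 s3" and l6: "lam 6 = cnj (lam 5)"
    and s_order: "0 < s1" "s1 \<le> s2" "s2 \<le> s3"
  shows "bdd_above (range (\<lambda>z. cmod (p z)))
       \<and> (SUP z. cmod (p z)) = s1 + s2 + s3
       \<and> (INF z. cmod (p z)) = (if s3 > s1 + s2 then s3 - s1 - s2 else 0)"
proof -
  define v1 v2 v3 where "v1 = lam 1" and "v2 = lam 3" and "v3 = lam 5"
  have Im: "Im v1 = s1" "Im v2 = s2" "Im v3 = s3" unfolding v1_def v2_def v3_def l1 l3 l5 by simp_all
  have ord: "0 < Im v1" "Im v1 \<le> Im v2" "Im v2 \<le> Im v3" using s_order by (simp_all add: Im)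
  have "{1..6::nat} = {1, 2, 3, 4, 5, 6}" by auto
  then have R: "spectral_R p c0 c1 c2 l z = (l-v1)*(l-cnj v1)*(l-v2)*(l-cnj v2)*(l-v3)*(l-cnj v3)" for l z
    using branch[rule_format, of l z] by (simp add: l2 l4 l6 v1_def v2_def v3_def mult.assoc)
  have ne: "lam j \<noteq> lam k" if "j \<in> {1..6}" "k \<in> {1..6}" "j \<noteq> k" for j k
    using nonsing that by blast
  have d: "v1 \<noteq> v2" "v1 \<noteq> cnj v2" "v1 \<noteq> v3" "v1 \<noteq> cnj v3" "v2 \<noteq> v3" "v2 \<noteq> cnj v3"
    unfolding v1_def v2_def v3_def l4[symmetric] l6[symmetric] by (rule ne; simp)+
  define u where "u = (\<lambda>z. (p z, Qcoef p c2 z, Wcoef p c1 c2 z))"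
  have bdd: "bounded (range u)" unfolding u_def by (rule bounded_spectral_data[OF smooth R])
  then have comp: "compact (closure (range u))" by (simp add: compact_closure)
  have u: "u z \<in> closure (range u)" for z by (rule subsetD[OF closure_subset]) simp
  have cont: "continuous_on (closure (range u)) (\<lambda>y. cmod (fst y))" by (intro continuous_intros)
  note identity = spectral_identity_closure[OF smooth R, folded u_def]
  note extremum = extremum_on_closure[OF smooth twophase bdd[unfolded u_def], folded u_def]

  obtain PM QM WM where M: "(PM, QM, WM) \<in> closure (range u)"
    and le_max: "\<And>y. y \<in> closure (range u) \<Longrightarrow> cmod (fst y) \<le> cmod PM"
    using continuous_attains_sup[OF comp _ cont] u by (metis empty_iff fst_conv prod.exhaust)
  obtain Pm Qm Wm where m: "(Pm, Qm, Wm) \<in> closure (range u)"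
    and ge_min: "\<And>y. y \<in> closure (range u) \<Longrightarrow> cmod Pm \<le> cmod (fst y)"
    using continuous_attains_inf[OF comp _ cont] u by (metis empty_iff fst_conv prod.exhaust)
  have p_le: "cmod (p z) \<le> cmod PM" and p_ge: "cmod Pm \<le> cmod (p z)" for z
    using le_max[OF u, of z] ge_min[OF u, of z] by (simp_all add: u_def)
  have PM: "PM \<noteq> 0" using nonzero p_le by (metis norm_le_zero_iff norm_zero)

  have max: "1 * (cmod (p z))\<^sup>2 \<le> 1 * (cmod PM)\<^sup>2" for z using p_le by (simp add: power_mono)
  have min: "- 1 * (cmod (p z))\<^sup>2 \<le> - 1 * (cmod Pm)\<^sup>2" for z using p_ge by (simp add: power_mono)
  note eM = extremum[OF M max] and em = extremum[OF m min]
  have vM: "cmod PM = s1 + s2 + s3 \<or> cmod PM = s3 - s1 - s2"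
    using extremal_value(1)[OF identity[OF M] d eM(1) PM ord, of 1] eM(2) by (simp add: Im)
  have vm: "cmod Pm = s1 + s2 + s3 \<or> cmod Pm = s3 - s1 - s2" if "Pm \<noteq> 0"
    using extremal_value(1)[OF identity[OF m] d em(1) that ord, of "- 1"] em(2) by (simp add: Im)
  \<comment> \<open>If the extrema agreed, the maximum point would also be a minimum point; the bend
    would be bounded by 0 from both sides and vanish in every direction.\<close>
  have distinct: "cmod Pm \<noteq> cmod PM"
  proof
    assume "cmod Pm = cmod PM"
    with min have "- 1 * (cmod (p z))\<^sup>2 \<le> - 1 * (cmod PM)\<^sup>2" for z by simp
    from extremum(2)[OF M this] eM(2) have "nu_bend c0 c1 c2 \<alpha> \<beta> PM QM WM = 0" for \<alpha> \<beta>
      by (simp add: antisym)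
    with extremal_value(2)[OF identity[OF M] d eM(1) PM ord] show False by simp
  qed
  have zero: "s3 \<le> s1 + s2" if "Pm = 0"
  proof -
    have "(l^3 + c2 * l\<^sup>2 + complex_of_real c1 * l + complex_of_real (hcoef c0 c2 0 Qm))\<^sup>2
        + (Qm * l + Wm) * (cnj Qm * l + cnj Wm)
        = (l-v1)*(l-cnj v1)*(l-v2)*(l-cnj v2)*(l-v3)*(l-cnj v3)" for l :: complex
      using identity[OF m, of l] that by simp
    from vanishing_amplitude[OF this ord] show ?thesis by (simp add: Im)
  qed
  have lt: "cmod Pm < cmod PM" using p_le[of 0] p_ge[of 0] distinct by linarith
  have pos: "0 < cmod PM" using PM by simp
  have vals: "cmod PM = s1 + s2 + s3 \<and> cmod Pm = (if s3 > s1 + s2 then s3 - s1 - s2 else 0)"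
  proof (cases "Pm = 0")
    case True
    \<comment> \<open>Here \<open>s3 - s1 - s2\<close> is nonpositive, hence not the value of the
      positive maximum.\<close>
    have "cmod PM = s1 + s2 + s3" using vM pos zero[OF True] by (elim disjE; linarith)
    then show ?thesis using True zero[OF True] by simp
  next
    case False
    then have "0 < cmod Pm" by simp
    \<comment> \<open>Two distinct values from the same pair of candidates: the larger is the sum
      and the smaller is the difference.\<close>
    have "cmod PM = s1 + s2 + s3" using vM vm[OF False] lt s_order by (elim disjE; linarith)
    moreover have "cmod Pm = s3 - s1 - s2" using vM vm[OF False] lt s_order by (elim disjE; linarith)
    ultimately show ?thesis using \<open>0 < cmod Pm\<close> by simp
  qed

  have above: "bdd_above (range (\<lambda>z. cmod (p z)))" by (rule bdd_aboveI2) (rule p_le)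
  have below: "bdd_below (range (\<lambda>z. cmod (p z)))" by (auto intro: bdd_belowI[of _ 0])
  \<comment> \<open>The maximum may be attained only in the closure, but the supremum over the orbit
    bounds \<open>cmod\<close> of the first component there too, by closedness.\<close>
  have "cmod PM \<le> (SUP z. cmod (p z))"
  proof -
    have "closure (range u) \<subseteq> {y. cmod (fst y) \<le> (SUP z. cmod (p z))}"
      by (rule closure_minimal) (auto simp: u_def intro!: closed_Collect_le continuous_intros cSUP_upper above)
    with M show ?thesis by auto
  qed
  then have sup: "(SUP z. cmod (p z)) = cmod PM"
    by (intro antisym cSUP_least) (auto simp: p_le)
  have "(INF z. cmod (p z)) \<le> cmod Pm"
  proof -
    have "closure (range u) \<subseteq> {y. (INF z. cmod (p z)) \<le> cmod (fst y)}"
      by (rule closure_minimal) (auto simp: u_def intro!: closed_Collect_le continuous_intros cINF_lower below)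
    with m show ?thesis by auto
  qed
  then have inf: "(INF z. cmod (p z)) = cmod Pm"
    by (intro antisym cINF_greatest) (auto simp: p_ge)
  show ?thesis using above sup inf vals by simp
qed

end
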